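(* Let $a$ and $r$ be integers with $r\ge 5$ and $2\le a\le\sqrt r$. Then $$\chi_Q(J(4r,2r-a,r-a))=4r$$ and $$\chi_Q(J(4r,2r+a,r+a))=4r.$$
   Context: For integers $0\le s\le k\le n$, the generalized Johnson graph $J(n,k,s)$ has as vertices all $k$-element subsets of $[n]=\{1,\dots,n\}$, and two distinct vertices $A,B$ are adjacent if and only if $|A\cap B|=s$. Quantum chromatic number: let $G$ be a finite simple graph and $c$ a positive integer. A quantum $c$-coloring of $G$ consists of a positive integer $m$ and Hermitian projectors $\mathbf{P}_{v,\alpha}\in\mathbb{C}^{m\times m}$ ($v\in V(G)$, $\alpha\in\{1,\dots,c\}$), i.e. $\mathbf{P}_{v,\alpha}^*=\mathbf{P}_{v,\alpha}=\mathbf{P}_{v,\alpha}^2$, such that (1) for every vertex $v$, $\mathbf{P}_{v,\alpha}\mathbf{P}_{v,\beta}=\mathbf{O}$ for $\alpha\ne\beta$ and $\sum_{\alpha=1}^c\mathbf{P}_{v,\alpha}=\mathbf{I}_m$; (2) for every edge $uv$ and every color $\alpha$, $\mathbf{P}_{u,\alpha}\mathbf{P}_{v,\alpha}=\mathbf{O}$. The quantum chromatic number $\chi_Q(G)$ is the least $c$ for which a quantum $c$-coloring of $G$ exists. *)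

theory Defs
  imports
    Complex_Main
    "Graph_Theory.Pair_Digraph"
    "Jordan_Normal_Form.Schur_Decomposition"
begin

text \<open>
  Finite simple graphs are the digraphs satisfying the locale \<open>pair_graph\<close>: every edge is
  represented by its two orientations in \<open>parcs G\<close>.
\<close>

definition gen_johnson_graph :: "nat \<Rightarrow> nat \<Rightarrow> nat \<Rightarrow> nat set pair_pre_digraph" where
  "gen_johnson_graph n k s =
     \<lparr> pverts = {A. A \<subseteq> {1..n} \<and> card A = k},
       parcs = {(A, B). A \<subseteq> {1..n} \<and> card A = k \<and> B \<subseteq> {1..n} \<and> card B = k \<and>
                        A \<noteq> B \<and> card (A \<inter> B) = s} \<rparr>"

lemma pair_graph_gen_johnson_graph: "pair_graph (gen_johnson_graph n k s)"
proof -
  have sub: "parcs (gen_johnson_graph n k s) \<subseteq> Pow {1..n} \<times> Pow {1..n}"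
    by (auto simp: gen_johnson_graph_def)
  show ?thesis
  proof
    show "finite (parcs (gen_johnson_graph n k s))"
      by (rule finite_subset[OF sub]) simp
    show "finite (pverts (gen_johnson_graph n k s))"
      by (simp add: gen_johnson_graph_def)
    show "symmetric (gen_johnson_graph n k s)"
      unfolding symmetric_def
    proof (rule symI)
      fix A B
      assume "(A, B) \<in> arcs_ends (gen_johnson_graph n k s)"
      then show "(B, A) \<in> arcs_ends (gen_johnson_graph n k s)"
        by (auto simp: gen_johnson_graph_def Int_commute[of B A])
    qed
  qed (simp_all add: gen_johnson_graph_def case_prod_beta)
qed

definition hermitian_projector :: "nat \<Rightarrow> complex mat \<Rightarrow> bool" where
  "hermitian_projector m P \<longleftrightarrow>
     P \<in> carrier_mat m m \<and> mat_adjoint P = P \<and> P * P = P"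

text \<open>
  The sum of square matrices of size \<open>m\<close> is the finite sum in the matrix ring \<open>ring_mat\<close>,
  since the type of all matrices has no additive unit.
\<close>

definition quantum_coloring ::
    "'a pair_pre_digraph \<Rightarrow> nat \<Rightarrow> nat \<Rightarrow> ('a \<Rightarrow> nat \<Rightarrow> complex mat) \<Rightarrow> bool" where
  "quantum_coloring G c m P \<longleftrightarrow>
     0 < c \<and> 0 < m \<and>
     (\<forall>v \<in> pverts G. \<forall>\<alpha> \<in> {1..c}. hermitian_projector m (P v \<alpha>)) \<and>
     (\<forall>v \<in> pverts G.
        (\<forall>\<alpha> \<in> {1..c}. \<forall>\<beta> \<in> {1..c}. \<alpha> \<noteq> \<beta> \<longrightarrow> P v \<alpha> * P v \<beta> = 0\<^sub>m m m) \<and>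
        finsum (ring_mat TYPE(complex) m ()) (P v) {1..c} = 1\<^sub>m m) \<and>
     (\<forall>(u, v) \<in> parcs G. \<forall>\<alpha> \<in> {1..c}. P u \<alpha> * P v \<alpha> = 0\<^sub>m m m)"

definition quantum_chromatic_number :: "'a pair_pre_digraph \<Rightarrow> nat" where
  "quantum_chromatic_number G = (LEAST c. \<exists>m P. quantum_coloring G c m P)"

text \<open>The minimum is attained: an injective colouring is a quantum colouring with \<open>m = 1\<close>.\<close>

lemma quantum_coloring_exists:
  assumes "pair_graph G"
  shows "\<exists>c m P. quantum_coloring G c m P"
proof -
  interpret pair_graph G by fact
  obtain f :: "'a \<Rightarrow> nat" and N where f: "f ` pverts G = {i. i < N}" "inj_on f (pverts G)"
    using finite_imp_inj_to_nat_seg[OF pair_finite_verts] by metis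
  define P :: "'a \<Rightarrow> nat \<Rightarrow> complex mat" where
    "P = (\<lambda>v \<alpha>. if \<alpha> = Suc (f v) then 1\<^sub>m 1 else 0\<^sub>m 1 1)"
  let ?R = "ring_mat TYPE(complex) 1 ()"
  interpret R: ring ?R by (rule ring_mat)
  have fin: "finsum ?R (P v) {1..Suc N} = 1\<^sub>m 1" if v: "v \<in> pverts G" for v
  proof -
    have "f v < N" using f(1) v by blast
    then have "finsum ?R (\<lambda>\<alpha>. if Suc (f v) = \<alpha> then (\<lambda>_. 1\<^sub>m 1) \<alpha> else \<zero>\<^bsub>?R\<^esub>) {1..Suc N} = 1\<^sub>m 1"
      by (intro R.add.finprod_singleton) (auto simp: ring_mat_simps)
    moreover have "P v = (\<lambda>\<alpha>. if Suc (f v) = \<alpha> then (\<lambda>_. 1\<^sub>m 1) \<alpha> else \<zero>\<^bsub>?R\<^esub>)"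
      by (auto simp: P_def ring_mat_simps fun_eq_iff)
    ultimately show ?thesis by simp
  qed
  have adj: "mat_adjoint (1\<^sub>m 1 :: complex mat) = 1\<^sub>m 1"
    "mat_adjoint (0\<^sub>m 1 1 :: complex mat) = 0\<^sub>m 1 1"
    by (auto simp: mat_adjoint_def mat_of_rows_def intro!: eq_matI)
  have edge: "f u \<noteq> f v" if "(u, v) \<in> parcs G" for u v
    using inj_on_eq_iff[OF f(2) wellformed'(1)[OF that] wellformed'(2)[OF that]]
      pair_no_loops[OF that] by simp
  have proj: "hermitian_projector 1 (P v \<alpha>)" for v \<alpha>
    using adj by (simp add: hermitian_projector_def P_def)
  have orth: "P u \<alpha> * P v \<beta> = 0\<^sub>m 1 1" if "\<alpha> \<noteq> Suc (f u) \<or> \<beta> \<noteq> Suc (f v)" for u v \<alpha> \<beta>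
    using that by (auto simp: P_def)
  have "P v \<alpha> * P v \<beta> = 0\<^sub>m 1 1" if "\<alpha> \<noteq> \<beta>" for v \<alpha> \<beta>
    using that by (intro orth) auto
  moreover have "P u \<alpha> * P v \<alpha> = 0\<^sub>m 1 1" if "(u, v) \<in> parcs G" for u v \<alpha>
    using edge[OF that] by (intro orth) auto
  ultimately have "quantum_coloring G (Suc N) 1 P"
    unfolding quantum_coloring_def using proj fin by blast
  then show ?thesis by blast
qed

end

theory Submission
  imports Defs "HOL-Analysis.Function_Topology" "HOL-Combinatorics.Transposition"
begin

text \<open>
  Encode a vertex \<open>A\<close> as a sign vector of length \<open>4r\<close>; in both graphs adjacent vertices have
  orthogonal sign vectors, so multiplying the Fourier basis pointwise by the sign vectors gives a
  quantum colouring with \<open>4r\<close> colours.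

  For the lower bound, a quantum \<open>c\<close>-colouring of a \<open>d\<close>-regular graph with least eigenvalue \<open>\<mu>\<close>
  satisfies \<open>d \<le> -\<mu> (c - 1)\<close>, so it suffices that \<open>(4r - 2) \<bar>\<lambda>\<^sub>j\<bar> < \<lambda>\<^sub>0\<close> for every eigenvalue
  \<open>\<lambda>\<^sub>j\<close> with \<open>j \<ge> 1\<close>. The three-term recurrence of the \<open>\<lambda>\<^sub>j\<close> in \<open>j\<close> obeys a maximum principle as
  long as \<open>j \<le> r\<close>, which reduces this to \<open>j = 1, 2\<close>; the condition \<open>a \<ge> 2\<close> is exactly what makes
  \<open>j = 2\<close> work. For \<open>j \<ge> r + 2\<close> the triangle inequality is enough.
\<close>

text \<open>The factor \<open>4r - 2\<close> is one less than a direct proof of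
  \<open>c >= 4r\<close> would ask for, and this is forced: for \<open>a = 2\<close> one has
  \<open>\<lambda>_2 < 0\<close> and \<open>\<lambda>_0 < (4r - 1) |\<lambda>_2|\<close>, so the
  eigenvalue bound stays below \<open>4r\<close> and gives it only because \<open>c\<close> is an
  integer. The spectrum is needed in one direction only: every eigenvalue is some
  \<open>\<lambda>_j\<close>. Hence neither multiplicities nor a full eigenbasis are computed. A
  minimiser of the quadratic form is an eigenvector; antisymmetrising it makes it explicit enough
  that the eigenvalue can be read off at a single vertex.\<close>

section \<open>Eigenvalues of generalized Johnson graphs\<close>

text \<open>Extending \<open>1/z!\<close> by \<open>0\<close> to negative integers makes contiguous binomial coefficients polynomial
  multiples of each other without boundary cases.\<close>

definition rfact :: "int \<Rightarrow> real" where
  "rfact z = (if z < 0 then 0 else inverse (fact (nat z)))"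

text \<open>The functional equation of \<open>1/Gamma(z + 1)\<close>. At \<open>z = 0\<close> both
  sides vanish and for negative \<open>z\<close> the default \<open>0\<close> agrees with it, so
  shifting an argument costs only a polynomial factor.\<close>

lemma rfact_pred: "rfact (z - 1) = of_int z * rfact z"
proof (cases "z \<le> 0")
  case True
  then show ?thesis by (auto simp: rfact_def)
next
  case False
  then obtain n where z: "z = int (Suc n)"
    by (metis not_le zero_less_imp_eq_int Suc_pred)
  show ?thesis
    by (simp add: z rfact_def nat_add_distrib)
qed

lemma rfact_pred2: "rfact (z - 2) = of_int (z - 1) * of_int z * rfact z"
  using rfact_pred[of z] rfact_pred[of "z - 1"] by simp

lemma binomial_rfact: "real (n choose k) = fact n * rfact (int k) * rfact (int n - int k)"
proof (cases "k \<le> n")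
  case True
  then show ?thesis
    by (simp add: rfact_def binomial_fact nat_diff_distrib field_simps flip: of_nat_diff)
qed (simp add: rfact_def)

text \<open>The eigenvalue \<open>\<lambda>\<^sub>j\<close> of \<open>J(n,k,s)\<close> for \<open>M = k\<close>, \<open>N = n - k\<close>, \<open>r = k - s\<close>. The guard \<open>i \<le> r\<close> is
  needed because \<open>r - i\<close> is truncated.\<close>

definition johnson_ev :: "nat \<Rightarrow> nat \<Rightarrow> nat \<Rightarrow> nat \<Rightarrow> real" where
  "johnson_ev M N r j = (\<Sum>i\<le>j. (-1) ^ i * real (j choose i) *
     (if i \<le> r then real ((M - j) choose (r - i)) * real ((N - j) choose (r - i)) else 0))"

text \<open>Taking complements of vertices exchanges the two graphs of the theorem; this is its
  trace on the eigenvalues, and it lets one family serve both.\<close>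

lemma johnson_ev_commute: "johnson_ev M N r j = johnson_ev N M r j"
  unfolding johnson_ev_def by (intro sum.cong refl) simp

lemma johnson_ev_0: "johnson_ev M N r 0 = real (M choose r) * real (N choose r)"
  by (simp add: johnson_ev_def)

text \<open>The summand of \<open>johnson_ev\<close> in reciprocal factorials. It vanishes for
  \<open>i > j\<close> and for \<open>i > r\<close>, so the sums for \<open>j - 1\<close>,
  \<open>j\<close> and \<open>Suc j\<close> can run over one common range.\<close>

definition ev_term :: "nat \<Rightarrow> nat \<Rightarrow> nat \<Rightarrow> nat \<Rightarrow> nat \<Rightarrow> real" where
  "ev_term M N r j i = (-1) ^ i * (fact j * fact (M - j) * fact (N - j)) *
     (rfact (int i) * rfact (int j - int i) * (rfact (int r - int i))\<^sup>2 *
      rfact (int M - int j - int r + int i) * rfact (int N - int j - int r + int i))"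

lemma johnson_ev_ev_term:
  assumes "j \<le> M" "j \<le> N" "j \<le> m"
  shows "johnson_ev M N r j = (\<Sum>i\<le>m. ev_term M N r j i)"
proof -
  have "johnson_ev M N r j = (\<Sum>i\<le>j. ev_term M N r j i)"
    unfolding johnson_ev_def
  proof (rule sum.cong[OF refl])
    fix i assume "i \<in> {..j}"
    show "(-1) ^ i * real (j choose i) *
        (if i \<le> r then real ((M - j) choose (r - i)) * real ((N - j) choose (r - i)) else 0)
      = ev_term M N r j i"
    proof (cases "i \<le> r")
      case True
      then show ?thesis
        using assms by (simp add: ev_term_def binomial_rfact of_nat_diff power2_eq_square algebra_simps)
    qed (simp add: ev_term_def rfact_def)
  qed
  also have "\<dots> = (\<Sum>i\<le>m. ev_term M N r j i)"
    using assms(3) by (intro sum.mono_neutral_left) (auto simp: ev_term_def rfact_def)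
  finally show ?thesis .
qed

text \<open>Zeilberger's algorithm: \<open>G\<close> is the telescoping certificate.\<close>

lemma johnson_ev_recurrence:
  fixes a r j :: nat
  defines "h \<equiv> 2 * real r - real j"
  assumes j: "j < 2 * r - a"
  shows "(2 * real r + 1 + h) * (h\<^sup>2 - (real a)\<^sup>2) * (h + 1) * johnson_ev (2*r - a) (2*r + a) r (Suc j)
    + (real a)\<^sup>2 * (2 * real r + 1) * (2 * h + 1) * johnson_ev (2*r - a) (2*r + a) r j
    + real j * ((h + 1)\<^sup>2 - (real a)\<^sup>2) * h * johnson_ev (2*r - a) (2*r + a) r (j - 1) = 0"
proof -
  define M where "M = 2*r - a"
  define N where "N = 2*r + a"
  have M: "real M = 2 * real r - real a" and N: "real N = 2 * real r + real a"
    and jM: "Suc j \<le> M" and jN: "Suc j \<le> N"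
    using j by (auto simp: M_def N_def)
  define K :: real where "K = fact j * fact (M - j) * fact (N - j)"
  define u v where "u i = int M - int j + 1 - int r + int i" and
    "v i = int N - int j + 1 - int r + int i" for i :: nat
  \<comment> \<open>The arguments are the largest ones among the summands for \<open>j - 1\<close>,
    \<open>j\<close> and \<open>Suc j\<close>; by \<open>rfact_pred\<close> all three are then
    polynomial multiples of \<open>B i\<close>.\<close>
  define B where "B i = rfact (int i) * rfact (int j + 1 - int i) * (rfact (int r - int i))\<^sup>2 *
      rfact (u i) * rfact (v i)" for i :: nat
  \<comment> \<open>The quadratic factor of the certificate; its coefficients solve the linear
    equations expressed by \<open>poly\<close> below.\<close>
  define p where "p x = - (2 * real r + 1 + h) * (h + 1) * ((real r + 1)\<^sup>2 - (real a)\<^sup>2) +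
     (x - real j - 1) * (h * (real a)\<^sup>2 - (real j + 1) * (h + 1) * (3 * h - 2 * real r)
       - (real j + 1) * (h + 1) * (x + real j + 1))" for x
  define G where "G i = (-1) ^ i * K * p (real i) * (real i * of_int (u i) * of_int (v i)) * B i" for i
  have Mj: "(real M - real j) * (real N - real j) = h\<^sup>2 - (real a)\<^sup>2"
    by (simp add: M N h_def power2_eq_square algebra_simps)
  have Mj1: "(real M - real j + 1) * (real N - real j + 1) = (h + 1)\<^sup>2 - (real a)\<^sup>2"
    by (simp add: M N h_def power2_eq_square algebra_simps)
  \<comment> \<open>The factor \<open>h^2 - a^2 = (M - j)(N - j)\<close> turns the factorials at
    \<open>Suc j\<close> into those of \<open>K\<close>; hence its place in the leading
    coefficient.\<close>
  have t1: "(h\<^sup>2 - (real a)\<^sup>2) * ev_term M N r (Suc j) i =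
      (-1) ^ i * K * (real j + 1) * (of_int (u i) * of_int (u i - 1) * of_int (v i) * of_int (v i - 1)) * B i" for i
  proof -
    obtain m m' where m: "M - j = Suc m" "N - j = Suc m'"
      using jM jN by (metis Suc_diff_Suc Suc_le_lessD)
    then have mm: "M - Suc j = m" "N - Suc j = m'" "real M - real j = real m + 1" "real N - real j = real m' + 1"
      using jM jN by linarith+
    have e: "int M - int (Suc j) - int r + int i = u i - 2" "int N - int (Suc j) - int r + int i = v i - 2"
      "int (Suc j) - int i = int j + 1 - int i"
      by (auto simp: u_def v_def)
    show ?thesis
      unfolding ev_term_def e rfact_pred2 Mj[symmetric] mm K_def m B_def
      by (simp add: algebra_simps)
  qed
  have t0: "ev_term M N r j i =
      (-1) ^ i * K * ((real j + 1 - real i) * of_int (u i) * of_int (v i)) * B i" for i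
  proof -
    have e: "int M - int j - int r + int i = u i - 1" "int N - int j - int r + int i = v i - 1"
      "int j - int i = (int j + 1 - int i) - 1"
      by (auto simp: u_def v_def)
    show ?thesis
      unfolding ev_term_def e rfact_pred K_def B_def
      by (simp add: algebra_simps)
  qed
  \<comment> \<open>At \<open>j = 0\<close> the predecessor truncates. The left side is then
    \<open>0\<close> through its factor \<open>j\<close>, and the right side because
    \<open>(1 - i)(0 - i)\<close> vanishes for \<open>i <= 1\<close>; this is why \<open>i\<close>
    is bounded.\<close>
  have tm: "real j * ev_term M N r (j - 1) i =
      (-1) ^ i * K * ((h + 1)\<^sup>2 - (real a)\<^sup>2) * ((real j + 1 - real i) * (real j - real i)) * B i"
    if "i \<le> Suc j" for i
  proof (cases j)
    case 0
    then show ?thesis using that by (cases i) auto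
  next
    case (Suc l)
    have m: "M - l = Suc (M - j)" "N - l = Suc (N - j)" "real (M - j) = real M - real j" "real (N - j) = real N - real j"
      using jM jN Suc by auto
    have e: "int M - int (j - 1) - int r + int i = u i" "int N - int (j - 1) - int r + int i = v i"
      "int (j - 1) - int i = (int j + 1 - int i) - 2"
      using Suc by (auto simp: u_def v_def)
    have f: "fact (M - (j - 1)) = (real M - real j + 1) * fact (M - j)"
       "fact (N - (j - 1)) = (real N - real j + 1) * fact (N - j)"
       "real j * fact (j - 1) = fact j"
      using m by (auto simp: Suc)
    have "real j * ev_term M N r (j - 1) i = (-1) ^ i * ((real j * fact (j - 1)) * fact (M - (j - 1)) * fact (N - (j - 1))) *
     (rfact (int i) * rfact (int (j-1) - int i) * (rfact (int r - int i))\<^sup>2 *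
      rfact (int M - int (j-1) - int r + int i) * rfact (int N - int (j-1) - int r + int i))"
      by (simp add: ev_term_def)
    also have "\<dots> = (-1) ^ i * (fact j * ((real M - real j + 1) * fact (M - j)) * ((real N - real j + 1) * fact (N - j))) *
     (rfact (int i) * (of_int (int j + 1 - int i - 1) * of_int (int j + 1 - int i) * rfact (int j + 1 - int i)) * (rfact (int r - int i))\<^sup>2 *
      rfact (u i) * rfact (v i))"
      unfolding f e rfact_pred2 ..
    also have "\<dots> = (-1) ^ i * K * ((real M - real j + 1) * (real N - real j + 1)) * ((real j + 1 - real i) * (real j - real i)) * B i"
      unfolding K_def B_def by (simp add: mult_ac)
    finally show ?thesis unfolding Mj1 .
  qed
  have G_Suc: "G (Suc i) = - ((-1) ^ i * K * p (real i + 1) * ((real j + 1 - real i) * (real r - real i)\<^sup>2) * B i)" for i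
  proof -
    have e: "u i = u (Suc i) - 1" "v i = v (Suc i) - 1" "int i = int (Suc i) - 1"
      by (auto simp: u_def v_def)
    have e': "int j + 1 - int (Suc i) = (int j + 1 - int i) - 1" "int r - int (Suc i) = (int r - int i) - 1" by auto
    have "rfact (int i) = real (Suc i) * rfact (int (Suc i))"
       "rfact (u i) = of_int (u (Suc i)) * rfact (u (Suc i))"
       "rfact (v i) = of_int (v (Suc i)) * rfact (v (Suc i))"
      using rfact_pred[of "int (Suc i)"] unfolding e(1,2) by (simp_all add: rfact_pred)
    moreover have "G (Suc i) = - ((-1) ^ i) * K * p (real i + 1) * 
      ((real (Suc i) * rfact (int (Suc i))) * (of_int (u (Suc i)) * rfact (u (Suc i))) * (of_int (v (Suc i)) * rfact (v (Suc i))))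
      * (of_int (int j + 1 - int i) * rfact (int j + 1 - int i)) * (of_int (int r - int i) * rfact (int r - int i))\<^sup>2"
      unfolding G_def B_def e' rfact_pred by (simp add: mult_ac add_ac)
    ultimately have "G (Suc i) = - ((-1) ^ i) * K * p (real i + 1) * 
      (rfact (int i) * rfact (u i) * rfact (v i))
      * (of_int (int j + 1 - int i) * rfact (int j + 1 - int i)) * (of_int (int r - int i) * rfact (int r - int i))\<^sup>2"
      by simp
    then show ?thesis
      unfolding B_def by (simp add: mult_ac power_mult_distrib)
  qed
  \<comment> \<open>Telescoping with the common factor \<open>(-1) ^ i * K * B i\<close> removed: an
    identity of polynomials in \<open>x\<close>, \<open>r\<close>, \<open>a\<close> and
    \<open>j\<close>.\<close>
  have poly: "(2 * real r + 1 + h) * (h + 1) * (real j + 1) * (U * (U - 1) * V * (V - 1))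
     + (real a)\<^sup>2 * (2 * real r + 1) * (2 * h + 1) * ((real j + 1 - x) * U * V)
     + h * ((h + 1)\<^sup>2 - (real a)\<^sup>2)\<^sup>2 * ((real j + 1 - x) * (real j - x))
     = - p (x + 1) * ((real j + 1 - x) * (real r - x)\<^sup>2) - p x * (x * U * V)"
    if "U = h - real a + 1 - real r + x" "V = h + real a + 1 - real r + x" for U V x
    unfolding that p_def h_def by Groebner_Basis.algebra
  have "(2 * real r + 1 + h) * (h\<^sup>2 - (real a)\<^sup>2) * (h + 1) * ev_term M N r (Suc j) i
      + (real a)\<^sup>2 * (2 * real r + 1) * (2 * h + 1) * ev_term M N r j i
      + real j * ((h + 1)\<^sup>2 - (real a)\<^sup>2) * h * ev_term M N r (j - 1) i = G (Suc i) - G i"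
    (is "?L = _") if "i \<le> Suc j" for i
  proof -
    have UV: "of_int (u i) = h - real a + 1 - real r + real i" "of_int (v i) = h + real a + 1 - real r + real i"
      by (auto simp: u_def v_def M N h_def)
    have "?L = (2 * real r + 1 + h) * (h + 1) * ((h\<^sup>2 - (real a)\<^sup>2) * ev_term M N r (Suc j) i)
      + (real a)\<^sup>2 * (2 * real r + 1) * (2 * h + 1) * ev_term M N r j i
      + ((h + 1)\<^sup>2 - (real a)\<^sup>2) * h * (real j * ev_term M N r (j - 1) i)"
      by (simp add: mult_ac)
    also have "\<dots> = (-1) ^ i * K * B i * ((2 * real r + 1 + h) * (h + 1) * (real j + 1) * (of_int (u i) * (of_int (u i) - 1) * of_int (v i) * (of_int (v i) - 1))
     + (real a)\<^sup>2 * (2 * real r + 1) * (2 * h + 1) * ((real j + 1 - real i) * of_int (u i) * of_int (v i))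
     + h * ((h + 1)\<^sup>2 - (real a)\<^sup>2)\<^sup>2 * ((real j + 1 - real i) * (real j - real i)))"
      unfolding t1 t0 tm[OF that] of_int_diff of_int_1
      by Groebner_Basis.algebra
    also have "\<dots> = G (Suc i) - G i"
      unfolding poly[OF UV] G_Suc G_def[of i] by Groebner_Basis.algebra
    finally show ?thesis .
  qed
  then have "(\<Sum>i\<le>Suc j. (2 * real r + 1 + h) * (h\<^sup>2 - (real a)\<^sup>2) * (h + 1) * ev_term M N r (Suc j) i
      + (real a)\<^sup>2 * (2 * real r + 1) * (2 * h + 1) * ev_term M N r j i
      + real j * ((h + 1)\<^sup>2 - (real a)\<^sup>2) * h * ev_term M N r (j - 1) i) = (\<Sum>i\<le>Suc j. G (Suc i) - G i)"
    by (intro sum.cong) auto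
  also have "\<dots> = G (Suc (Suc j)) - G 0"
    by (induction j) simp_all
  \<comment> \<open>\<open>G 0\<close> contains the factor \<open>0\<close>, and
    \<open>G (Suc (Suc j))\<close> contains \<open>rfact (-1) = 0\<close>.\<close>
  also have "\<dots> = 0"
    by (simp add: G_def B_def rfact_def)
  finally show ?thesis
    unfolding M_def[symmetric] N_def[symmetric] sum.distrib sum_distrib_left[symmetric]
    using johnson_ev_ev_term[of "Suc j" M N "Suc j" r] johnson_ev_ev_term[of j M N "Suc j" r]
      johnson_ev_ev_term[of "j - 1" M N "Suc j" r] jM jN by simp
qed

text \<open>One of the two binomials is bounded by \<open>2 ^ (N - j)\<close>; the rest sums to
  \<open>M choose r\<close> by Vandermonde. Since \<open>\<lambda>_0\<close> is
  \<open>M choose r\<close> times \<open>N choose r\<close>, only \<open>2 ^ (N - j)\<close> and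
  \<open>N choose r\<close> remain to be compared.\<close>

lemma abs_johnson_ev_le:
  assumes "j \<le> M"
  shows "\<bar>johnson_ev M N r j\<bar> \<le> real (M choose r) * 2 ^ (N - j)"
proof -
  let ?t = "\<lambda>i. if i \<le> r then real ((M - j) choose (r - i)) * real ((N - j) choose (r - i)) else 0"
  have "\<bar>johnson_ev M N r j\<bar> \<le> (\<Sum>i\<le>j. \<bar>(-1) ^ i * real (j choose i) * ?t i\<bar>)"
    unfolding johnson_ev_def by (rule sum_abs)
  also have "\<dots> \<le> (\<Sum>i\<le>j. (if i \<le> r then real (j choose i) * real ((M - j) choose (r - i)) else 0) * 2 ^ (N - j))"
  proof (rule sum_mono)
    fix i
    have "real ((N - j) choose (r - i)) \<le> 2 ^ (N - j)"
      using binomial_le_pow2[of "N - j" "r - i"] by (metis of_nat_le_iff of_nat_numeral of_nat_power)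
    then show "\<bar>(-1) ^ i * real (j choose i) * ?t i\<bar> \<le>
        (if i \<le> r then real (j choose i) * real ((M - j) choose (r - i)) else 0) * 2 ^ (N - j)"
      by (auto simp: abs_mult mult.assoc intro!: mult_left_mono)
  qed
  also have "\<dots> = (\<Sum>i\<le>j. if i \<le> r then real (j choose i) * real ((M - j) choose (r - i)) else 0) * 2 ^ (N - j)"
    by (simp add: sum_distrib_right)
  also have "(\<Sum>i\<le>j. if i \<le> r then real (j choose i) * real ((M - j) choose (r - i)) else 0) =
     (\<Sum>i\<le>max j r. if i \<le> r then real (j choose i) * real ((M - j) choose (r - i)) else 0)"
    by (intro sum.mono_neutral_left) auto
  also have "\<dots> = (\<Sum>i\<le>r. real (j choose i) * real ((M - j) choose (r - i)))"
    by (intro sum.mono_neutral_cong_right) auto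
  also have "\<dots> = real (M choose r)"
    using vandermonde[of j "M - j" r] assms by (simp flip: of_nat_mult of_nat_sum)
  finally show ?thesis .
qed

section \<open>Exponential lower bounds for binomial coefficients\<close>

lemma five_thirds_power_le_binomial:
  "2 * a \<le> r \<Longrightarrow> (5 / 3) ^ a * real ((2 * r) choose r) \<le> real ((2 * r + a) choose r)"
proof (induction a)
  case (Suc a)
  have "(5 / 3) * real ((2 * r + a) choose r) \<le> real ((2 * r + Suc a) choose r)"
  proof -
    have "Suc (2*r+a) - r = Suc (r + a)" by simp
    then have "real (r + a + 1) * real ((2 * r + Suc a) choose r) = real (2 * r + a + 1) * real ((2 * r + a) choose r)"
      using arg_cong[OF binomial_absorb_comp[of "2*r + Suc a" r], of real]
      unfolding of_nat_mult by (simp add: algebra_simps)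
    \<comment> \<open>The quotient of consecutive binomials is
      \<open>(2r + a + 1) / (r + a + 1)\<close>, which is at least \<open>5/3\<close> exactly when
      \<open>2 (a + 1) <= r\<close>.\<close>
    moreover have "real (2*r+a+1) \<ge> 5 / 3 * real (r + a + 1)"
      using Suc.prems by simp
    ultimately have "real (r + a + 1) * real ((2 * r + Suc a) choose r) \<ge> (5 / 3 * real (r + a + 1)) * real ((2 * r + a) choose r)"
      by (metis mult_right_mono of_nat_0_le_iff)
    then have "real (r + a + 1) * ((5 / 3) * real ((2 * r + a) choose r)) \<le> real (r + a + 1) * real ((2 * r + Suc a) choose r)"
      by (simp only: mult_ac)
    then show ?thesis by (rule mult_left_le_imp_le) simp
  qed
  moreover have "(5 / 3) ^ a * real ((2 * r) choose r) \<le> real ((2 * r + a) choose r)"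
    using Suc by simp
  ultimately show ?case by simp
qed simp

text \<open>The factor \<open>(11/10) ^ r\<close> is slack, spent later on \<open>2 ^ a\<close>. At
  \<open>r = 5\<close> the sides are about \<open>231.9\<close> and \<open>252\<close>; one step
  multiplies the right side by \<open>(4r + 2) / (r + 1)\<close> and the left side by the smaller
  \<open>(11/5) (4r + 2) / (4r - 2)\<close>.\<close>

lemma central_binomial_gt:
  "r \<ge> 5 \<Longrightarrow> (4 * real r - 2) * 2 ^ (r - 2) * (11 / 10) ^ r < real ((2 * r) choose r)"
proof (induction r rule: nat_induct_at_least)
  case base
  have "(10::nat) choose 5 = 252" by (simp add: numeral_eq_Suc)
  then show ?case by (simp add: power_divide)
next
  case (Suc r)
  have "real (r + 1) * real ((2 * Suc r) choose Suc r) = (4 * real r + 2) * real ((2 * r) choose r)"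
  proof -
    have "Suc r * ((2 * Suc r) choose Suc r) = (2 * Suc r) * (Suc (2 * r) choose r)"
      using binomial_absorption[of r "Suc (Suc (2 * r))"] by (simp del: binomial_Suc_Suc)
    moreover have "Suc r * (Suc (2 * r) choose r) = Suc (2 * r) * ((2 * r) choose r)"
      using binomial_absorb_comp[of "Suc (2 * r)" r] by (simp del: binomial_Suc_Suc add: Suc_diff_le)
    ultimately have "Suc r * (Suc r * ((2 * Suc r) choose Suc r)) = Suc r * ((4 * r + 2) * ((2 * r) choose r))"
      by (simp add: algebra_simps)
    then have "Suc r * ((2 * Suc r) choose Suc r) = (4 * r + 2) * ((2 * r) choose r)"
      by (simp only: mult_cancel1) simp
    then have "real (Suc r * ((2 * Suc r) choose Suc r)) = real ((4 * r + 2) * ((2 * r) choose r))"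
      by (rule arg_cong)
    then show ?thesis by (simp del: binomial_Suc_Suc add: algebra_simps)
  qed
  moreover have "(4 * real r + 2) * ((4 * real r - 2) * 2 ^ (r - 2) * (11 / 10) ^ r) < (4 * real r + 2) * real ((2 * r) choose r)"
    using Suc by (intro mult_strict_left_mono) auto
  moreover have "real (r + 1) * ((4 * real (Suc r) - 2) * 2 ^ (Suc r - 2) * (11 / 10) ^ Suc r) =
     (11 / 5 * real (r + 1)) * ((4 * real r + 2) * 2 ^ (r - 2) * (11 / 10) ^ r)"
  proof -
    have "Suc r - 2 = Suc (r - 2)" using Suc.hyps by simp
    then show ?thesis by (simp only: power_Suc) (simp add: algebra_simps)
  qed
  moreover have "\<dots> \<le> (4 * real r - 2) * ((4 * real r + 2) * 2 ^ (r - 2) * (11 / 10) ^ r)"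
    using Suc.hyps by (intro mult_right_mono) auto
  ultimately have "real (r + 1) * ((4 * real (Suc r) - 2) * 2 ^ (Suc r - 2) * (11 / 10) ^ Suc r) < real (r + 1) * real ((2 * Suc r) choose Suc r)"
    by (simp only: mult_ac)
  then show ?case by (rule mult_left_less_imp_less) simp
qed

text \<open>The exponent is \<open>N - j\<close> for \<open>N = 2r + a\<close> and
  \<open>j = r + 2\<close>. Of \<open>2 = (5/3)(6/5)\<close>, the power \<open>(5/3)^a\<close> is
  absorbed by the growth of the binomial in \<open>a\<close>, and
  \<open>(6/5)^a <= (11/10)^(2a) <= (11/10)^r\<close> by the slack.\<close>

lemma pow2_less_binomial:
  assumes "r \<ge> 5" "2 * a \<le> r"
  shows "(4 * real r - 2) * 2 ^ (r - 2 + a) < real ((2 * r + a) choose r)"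
proof -
  have "(4 * real r - 2) * 2 ^ (r - 2 + a) = (5 / 3) ^ a * ((4 * real r - 2) * 2 ^ (r - 2) * (6 / 5) ^ a)"
    by (simp add: power_add mult_ac flip: power_mult_distrib)
  also have "(6 / 5 :: real) ^ a \<le> ((11 / 10)\<^sup>2) ^ a"
    by (intro power_mono) (auto simp: power2_eq_square)
  also have "((11 / 10)\<^sup>2) ^ a \<le> (11 / 10 :: real) ^ r"
    unfolding power_mult[symmetric] using assms by (intro power_increasing) auto
  also have "(4 * real r - 2) * 2 ^ (r - 2) * (11 / 10) ^ r < real ((2 * r) choose r)"
    by (rule central_binomial_gt) fact
  also have "(5 / 3) ^ a * real ((2 * r) choose r) \<le> real ((2 * r + a) choose r)"
    by (rule five_thirds_power_le_binomial) fact
  finally show ?thesis using assms by (simp add: mult_left_mono)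
qed

section \<open>The gap between the degree and the other eigenvalues\<close>

lemma johnson_ev_small:
  fixes a r :: nat
  assumes r: "r \<ge> 5" and a: "2 \<le> a" "a\<^sup>2 \<le> r" and j: "1 \<le> j" "j \<le> 2 * r - a"
  defines "L \<equiv> johnson_ev (2*r - a) (2*r + a) r"
  shows "(4 * real r - 2) * \<bar>L j\<bar> < L 0"
proof -
  have a2: "2 * a \<le> r"
    using a by (metis mult_le_mono1 order_trans power2_eq_square)
  define x where "x = (real a)\<^sup>2"
  have x: "x \<le> real r" "4 \<le> x"
    unfolding x_def using a power_mono[of 2 "real a" 2]
    by (simp_all flip: of_nat_power)
  have L0: "L 0 = real ((2*r - a) choose r) * real ((2*r + a) choose r)"
    by (simp add: L_def johnson_ev_0)
  have L0_pos: "L 0 > 0"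
    using a2 unfolding L0 by (intro mult_pos_pos) auto
  have rr: "5 \<le> real r" using r by simp
  define R where "R = real r"
  have R: "5 \<le> R" "x \<le> R" using rr x by (auto simp: R_def)
  have xR: "x < 4 * R\<^sup>2" using R by (simp add: power2_eq_square) (smt (verit) mult_le_cancel_right1)
  have rec: "(2 * R + 1 + h) * (h\<^sup>2 - x) * (h + 1) * L (Suc i) + x * (2 * R + 1) * (2 * h + 1) * L i
     + real i * ((h + 1)\<^sup>2 - x) * h * L (i - 1) = 0" if "i < 2 * r - a" "h = 2 * R - real i" for h i
    using johnson_ev_recurrence[OF that(1)] that(2) unfolding L_def R_def x_def by simp
  have L1: "(4 * R\<^sup>2 - x) * L 1 = - x * L 0"
  proof -
    have "((4 * R + 1) * (2 * R + 1)) * ((4 * R\<^sup>2 - x) * L 1 + x * L 0) = 0"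
      using rec[of 0 "2 * R"] a2 r by (simp add: algebra_simps power2_eq_square)
    then show ?thesis using R by auto
  qed
  have L2: "4 * R * ((2 * R - 1)\<^sup>2 - x) * (2 * R) * L 2 =
     - (x * (2 * R + 1) * (4 * R - 1)) * L 1 - (4 * R\<^sup>2 - x) * (2 * R - 1) * L 0"
    using rec[of 1 "2 * R - 1"] a2 r by (simp add: algebra_simps power2_eq_square numeral_2_eq_2)
  have small1: "(4 * R - 2) * \<bar>L 1\<bar> < L 0"
  proof -
    have "(4 * R\<^sup>2 - x) * ((4 * R - 2) * \<bar>L 1\<bar>) = (4 * R - 2) * \<bar>(4 * R\<^sup>2 - x) * L 1\<bar>"
      using xR by (simp add: abs_mult)
    also have "\<dots> = ((4 * R - 2) * x) * L 0"
      unfolding L1 using x L0_pos by (simp add: abs_mult)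
    also have "\<dots> < (4 * R\<^sup>2 - x) * L 0"
    proof (intro mult_strict_right_mono L0_pos)
      \<comment> \<open>Here \<open>a^2 <= r\<close> enters; at \<open>x = R\<close> the quotient of
        \<open>L 0\<close> and \<open>|L 1|\<close> is exactly \<open>4R - 1\<close>.\<close>
      have "(4 * R - 1) * x \<le> (4 * R - 1) * R" using R by (intro mult_left_mono) auto
      then show "(4 * R - 2) * x < 4 * R\<^sup>2 - x" using R by (simp add: algebra_simps power2_eq_square)
    qed
    finally show ?thesis using xR by (simp add: mult_less_cancel_left_pos)
  qed
  have small2: "(4 * R - 2) * \<bar>L 2\<bar> < L 0"
  proof -
    \<comment> \<open>Eliminating \<open>L 1\<close> between \<open>L1\<close> and \<open>L2\<close>
      and cancelling \<open>8 R^2\<close> leaves \<open>D * L 2 = - w * L 0\<close>.\<close>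
    define D where "D = (4 * R\<^sup>2 - x) * ((2 * R - 1)\<^sup>2 - x)"
    define w where "w = (2 * R - 1) * (2 * R\<^sup>2 - x) - x\<^sup>2"
    have RR: "5 * R \<le> R * R" using R by simp
    have "(2 * R - 1)\<^sup>2 = 4 * (R * R) - 4 * R + 1" by (simp add: power2_eq_square algebra_simps)
    then have "(2 * R - 1)\<^sup>2 - x > 0" using RR R by linarith
    then have D: "D > 0"
      unfolding D_def using xR by (intro mult_pos_pos) simp_all
    have "8 * R\<^sup>2 * (D * L 2 + w * L 0) = 0"
      using L1 L2 unfolding D_def w_def by Groebner_Basis.algebra
    then have DL: "D * L 2 = - w * L 0" using R by simp
    have "x\<^sup>2 \<le> R\<^sup>2" using x R by (intro power_mono) auto
    moreover have "x \<le> 2 * R\<^sup>2" using RR R unfolding power2_eq_square by linarith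
    then have "9 * (2 * R\<^sup>2 - x) \<le> (2 * R - 1) * (2 * R\<^sup>2 - x)"
      using R by (intro mult_right_mono) auto
    ultimately have w: "w \<ge> 0" using RR R unfolding w_def power2_eq_square
      by (simp only: right_diff_distrib left_diff_distrib)
    \<comment> \<open>At \<open>x = 1\<close> the right side is zero, so for \<open>a = 1\<close>
      the strict inequality would become an equality.\<close>
    have "D - (4 * R - 2) * w = (4 * R - 1) * (x * (x - 1))"
      unfolding D_def w_def by Groebner_Basis.algebra
    also have "\<dots> > 0" using R x by (intro mult_pos_pos) auto
    finally have Dw: "(4 * R - 2) * w < D" by simp
    have "D * ((4 * R - 2) * \<bar>L 2\<bar>) = (4 * R - 2) * \<bar>D * L 2\<bar>"
      using D by (simp add: abs_mult)
    also have "\<dots> = ((4 * R - 2) * w) * L 0"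
      unfolding DL using w L0_pos by (simp add: abs_mult)
    also have "\<dots> < D * L 0"
      using Dw L0_pos by (rule mult_strict_right_mono)
    finally show ?thesis using D by (simp add: mult_less_cancel_left_pos)
  qed
  have step: "(4 * R - 2) * \<bar>L (Suc i)\<bar> < L 0"
    if i: "2 \<le> i" "i \<le> r" and IH: "(4 * R - 2) * \<bar>L i\<bar> < L 0" "(4 * R - 2) * \<bar>L (i - 1)\<bar> < L 0" for i
  proof -
    define h where "h = 2 * R - real i"
    have h: "R \<le> h" "h \<le> 2 * R - 2" using i by (auto simp: h_def R_def)
    have Rh: "R * R \<le> R * h" "R * h \<le> h * h" "5 * R \<le> R * R" "5 * h \<le> R * h" using h R by (auto intro: mult_left_mono mult_right_mono)
    define A B C where "A = (2 * R + 1 + h) * (h\<^sup>2 - x) * (h + 1)" and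
      "B = x * (2 * R + 1) * (2 * h + 1)" and "C = real i * ((h + 1)\<^sup>2 - x) * h"
    have hx: "h\<^sup>2 - x > 0"
      using Rh R unfolding power2_eq_square by linarith
    then have hx1: "(h + 1)\<^sup>2 - x > 0" using h R by (simp add: power2_eq_square algebra_simps)
    have pos: "A > 0" "B > 0" "C > 0"
      using hx hx1 h R i x unfolding A_def B_def C_def by (auto intro!: mult_pos_pos)
    \<comment> \<open>\<open>B + C <= A\<close> means that \<open>A\<close> is at least half of this
      sum. Both \<open>A\<close> and the sum contain \<open>h + 1\<close>; removing it leaves
      \<open>key\<close>.\<close>
    have ABC: "A + B + C = R * (2 * h * (h + 1) * (2 * h + 1))"
    proof -
      have "real i = 2 * R - h" by (simp add: h_def)
      then show ?thesis unfolding A_def B_def C_def by Groebner_Basis.algebra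
    qed
    \<comment> \<open>The cubic term in \<open>h\<close> dominates because
      \<open>x <= R <= h\<close> and \<open>h >= 5\<close>; \<open>R <= h\<close> is the condition
      \<open>i <= r\<close>.\<close>
    have key: "R * h * (2 * h + 1) \<le> (2 * R + 1 + h) * (h\<^sup>2 - x)"
    proof -
      have "(2 * R + 1 + h) * x \<le> (2 * R + 1 + h) * R" using R h by (intro mult_left_mono) auto
      also have "\<dots> = 2 * (R * R) + R + R * h" by Groebner_Basis.algebra
      finally have "(2 * R + 1 + h) * x \<le> 2 * (R * R) + R + R * h" .
      moreover have "5 * (h * h) \<le> h * (h * h)" using R h by (intro mult_right_mono) auto
      moreover have "(2 * R + 1 + h) * (h\<^sup>2 - x) - R * h * (2 * h + 1) =
          h * (h * h) + h * h - R * h - (2 * R + 1 + h) * x" by Groebner_Basis.algebra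
      ultimately show ?thesis using Rh R h by linarith
    qed
    have "(h + 1) * (R * h * (2 * h + 1)) \<le> (h + 1) * ((2 * R + 1 + h) * (h\<^sup>2 - x))"
      using key h R by (intro mult_left_mono) auto
    then have BCA: "B + C \<le> A" using ABC unfolding A_def[symmetric] by (simp add: A_def algebra_simps)
    have "A * L (Suc i) = - B * L i - C * L (i - 1)"
    proof -
      have "i < 2 * r - a" using i a2 r by linarith
      then show ?thesis using rec[OF _ h_def] unfolding A_def B_def C_def by (simp add: algebra_simps)
    qed
    then have "A * \<bar>L (Suc i)\<bar> = \<bar>- B * L i - C * L (i - 1)\<bar>"
      using pos by (metis abs_mult abs_of_pos)
    also have "\<dots> \<le> B * \<bar>L i\<bar> + C * \<bar>L (i - 1)\<bar>"
      using pos abs_triangle_ineq4[of "- B * L i" "C * L (i - 1)"] by (simp add: abs_mult)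
    finally have "(4 * R - 2) * (A * \<bar>L (Suc i)\<bar>) \<le> (4 * R - 2) * (B * \<bar>L i\<bar> + C * \<bar>L (i - 1)\<bar>)"
      using R by (intro mult_left_mono) auto
    also have "\<dots> = B * ((4 * R - 2) * \<bar>L i\<bar>) + C * ((4 * R - 2) * \<bar>L (i - 1)\<bar>)"
      by (simp add: algebra_simps)
    also have "\<dots> < B * L 0 + C * L 0"
      using pos IH by (intro add_strict_mono mult_strict_left_mono)
    also have "\<dots> \<le> A * L 0"
      using BCA L0_pos by (simp flip: distrib_right)
    finally have "A * ((4 * R - 2) * \<bar>L (Suc i)\<bar>) < A * L 0" by (simp only: mult_ac)
    then show ?thesis using pos by (simp add: mult_less_cancel_left_pos)
  qed
  have low: "(4 * R - 2) * \<bar>L i\<bar> < L 0" if "1 \<le> i" "i \<le> Suc r" for i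
    using that
  proof (induction i rule: less_induct)
    case (less i)
    consider "i = 1" | "i = 2" | "i = Suc (i - 1)" "2 \<le> i - 1" "i - 1 \<le> r"
      using less.prems by linarith
    then show ?case
    proof cases
      case 3
      then show ?thesis using step[of "i - 1"] less.IH[of "i - 1"] less.IH[of "i - 1 - 1"] by simp
    qed (use small1 small2 in auto)
  qed
  show ?thesis
  proof (cases "j \<le> Suc r")
    case True
    then show ?thesis using low[of j] j by (simp add: R_def)
  next
    case False
    \<comment> \<open>Now \<open>j >= r + 2\<close>, so \<open>N - j\<close> is at most
      \<open>r - 2 + a\<close>.\<close>
    have "(4 * real r - 2) * \<bar>L j\<bar> \<le> (4 * real r - 2) * (real ((2*r - a) choose r) * 2 ^ (2*r + a - j))"
      unfolding L_def using rr by (intro mult_left_mono abs_johnson_ev_le j) auto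
    also have "\<dots> \<le> (4 * real r - 2) * (real ((2*r - a) choose r) * 2 ^ (r - 2 + a))"
      using False rr by (intro mult_left_mono power_increasing) auto
    also have "\<dots> = real ((2*r - a) choose r) * ((4 * real r - 2) * 2 ^ (r - 2 + a))"
      by simp
    also have "\<dots> < L 0"
      unfolding L0 using a2 by (intro mult_strict_left_mono pow2_less_binomial r) auto
    finally show ?thesis .
  qed
qed

section \<open>The least eigenvalue\<close>

lemma quadratic_nonneg_imp_linear_zero:
  fixes b c :: real
  assumes "\<And>t. 0 \<le> 2 * t * b + t\<^sup>2 * c"
  shows "b = 0"
proof (rule ccontr)
  assume "b \<noteq> 0"
  \<comment> \<open>The choice \<open>|c| + 1\<close> keeps \<open>d\<close> positive and above
    \<open>c\<close> whatever the sign of \<open>c\<close>, so the quadratic is negative at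
    \<open>t = - b / d\<close>.\<close>
  define d where "d = \<bar>c\<bar> + 1"
  have d: "d > 0" "c < d" by (auto simp: d_def)
  have "2 * (- b / d) * b + (- b / d)\<^sup>2 * c = (b\<^sup>2 / d) * (c / d - 2)"
    using d by (simp add: field_simps power2_eq_square)
  moreover have "c / d - 2 < 0" using d by (simp add: field_simps)
  moreover have "b\<^sup>2 / d > 0" using d \<open>b \<noteq> 0\<close> by simp
  ultimately show False
    using assms[of "- b / d"] by (metis mult_pos_neg not_le)
qed

text \<open>The form attains its minimum \<open>\<mu>\<close> on the unit sphere, and the
  first-order condition along coordinate directions is the eigenvalue equation. The eigenvector
  serves to identify \<open>\<mu>\<close>, the inequality to bound the number of colours.\<close>

lemma symmetric_min_eigenvector:
  fixes M :: "'a \<Rightarrow> 'a \<Rightarrow> real"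
  assumes V: "finite V" "V \<noteq> {}" and sym: "\<And>x y. x \<in> V \<Longrightarrow> y \<in> V \<Longrightarrow> M x y = M y x"
  obtains \<mu> f where "\<exists>x\<in>V. f x \<noteq> 0"
    and "\<And>x. x \<in> V \<Longrightarrow> (\<Sum>y\<in>V. M x y * f y) = \<mu> * f x"
    and "\<And>g. \<mu> * (\<Sum>x\<in>V. (g x)\<^sup>2) \<le> (\<Sum>x\<in>V. \<Sum>y\<in>V. M x y * g x * g y)"
proof -
  define Q where "Q g = (\<Sum>x\<in>V. \<Sum>y\<in>V. M x y * g x * g y)" for g :: "'a \<Rightarrow> real"
  define N where "N g = (\<Sum>x\<in>V. (g x)\<^sup>2)" for g :: "'a \<Rightarrow> real"
  \<comment> \<open>Fixing the value \<open>0\<close> outside \<open>V\<close> makes the domain a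
    product of compact sets over the whole type, so Tychonoff applies even if the type is
    infinite.\<close>
  define box where "box = PiE UNIV (\<lambda>x. if x \<in> V then {-1..1} else {0 :: real})"
  define S where "S = box \<inter> {g. N g = 1}"
  have "compactin (product_topology (\<lambda>_. euclidean) UNIV) box"
    unfolding box_def by (subst compactin_PiE) auto
  then have "compact box"
    by (simp add: euclidean_product_topology)
  moreover have "continuous_on UNIV N"
    unfolding N_def by (intro continuous_intros continuous_on_product_coordinates)
  then have "closed {g. N g = 1}"
    by (rule closed_Collect_eq) (rule continuous_on_const)
  ultimately have S: "compact S"
    unfolding S_def by (rule compact_Int_closed)
  obtain x0 where x0: "x0 \<in> V" using V by auto
  have "(\<lambda>x. if x = x0 then 1 else 0) \<in> S"
    unfolding S_def box_def N_def PiE_UNIV_domain using V x0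
    by (simp add: if_distrib[of "\<lambda>z. z\<^sup>2"] cong: if_cong)
  then have S_ne: "S \<noteq> {}" by blast
  have "continuous_on S Q"
    unfolding Q_def
    by (intro continuous_intros continuous_on_subset[OF continuous_on_product_coordinates subset_UNIV])
  then obtain f where f: "f \<in> S" and min: "\<And>g. g \<in> S \<Longrightarrow> Q f \<le> Q g"
    using continuous_attains_inf[OF S S_ne] by metis
  have Nf: "N f = 1" using f by (simp add: S_def)
  have Q_ge: "Q f * N g \<le> Q g" for g
  proof (cases "N g = 0")
    case True
    then have "g x = 0" if "x \<in> V" for x
      using that V by (simp add: N_def sum_nonneg_eq_0_iff)
    then have "Q g = 0" by (simp add: Q_def)
    then show ?thesis using True by simp
  next
    case False
    then have pos: "N g > 0" by (metis N_def order_le_less sum_nonneg zero_le_power2)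
    define c where "c = sqrt (N g)"
    have c: "c > 0" "c\<^sup>2 = N g" using pos by (auto simp: c_def)
    define g' where "g' x = (if x \<in> V then g x / c else 0)" for x
    have N': "N g' = 1"
      unfolding N_def g'_def using c pos
      by (simp add: power_divide flip: sum_divide_distrib) (simp add: N_def)
    have "g' x \<in> (if x \<in> V then {-1..1} else {0})" for x
    proof (cases "x \<in> V")
      case True
      then have "(g' x)\<^sup>2 \<le> 1"
        unfolding N'[symmetric] N_def using V by (intro member_le_sum) auto
      then show ?thesis using True by (simp add: abs_square_le_1 abs_le_iff)
    qed (simp add: g'_def)
    then have "g' \<in> S"
      unfolding S_def box_def using N' by blast
    then have "Q f \<le> Q g'" by (rule min)
    also have "Q g' = Q g / N g"
      unfolding Q_def g'_def c(2)[symmetric]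
      by (simp add: power2_eq_square sum_divide_distrib)
    finally show ?thesis using pos by (simp add: field_simps)
  qed
  have eig: "(\<Sum>y\<in>V. M x y * f y) = Q f * f x" if x: "x \<in> V" for x
  proof -
    \<comment> \<open>This quadratic in \<open>t\<close> is \<open>Q g - Q f * N g\<close> at
      \<open>g = f + t * e\<close>, with \<open>e\<close> the indicator of \<open>x\<close>.\<close>
    have "0 \<le> 2 * t * ((\<Sum>y\<in>V. M x y * f y) - Q f * f x) + t\<^sup>2 * (M x x - Q f)" for t
    proof -
      define e where "e y = (if y = x then t else 0)" for y
      have "Q (\<lambda>y. f y + e y) = Q f + (\<Sum>z\<in>V. \<Sum>y\<in>V. M z y * f z * e y)
          + (\<Sum>z\<in>V. \<Sum>y\<in>V. M z y * e z * f y) + (\<Sum>z\<in>V. \<Sum>y\<in>V. M z y * e z * e y)"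
        unfolding Q_def by (simp add: algebra_simps sum.distrib)
      also have "(\<Sum>z\<in>V. \<Sum>y\<in>V. M z y * f z * e y) = t * (\<Sum>z\<in>V. M x z * f z)"
        unfolding e_def using V x sym
        by (simp add: if_distrib[of "\<lambda>w. _ * w"] sum_distrib_left mult_ac cong: if_cong)
      also have "(\<Sum>z\<in>V. \<Sum>y\<in>V. M z y * e z * f y) = (\<Sum>z\<in>V. e z * (\<Sum>y\<in>V. M z y * f y))"
        by (simp add: sum_distrib_left mult_ac)
      also have "\<dots> = t * (\<Sum>z\<in>V. M x z * f z)"
        unfolding e_def using V x by (simp add: if_distrib[of "\<lambda>w. w * _"] cong: if_cong)
      also have "(\<Sum>z\<in>V. \<Sum>y\<in>V. M z y * e z * e y) = (\<Sum>z\<in>V. e z * (\<Sum>y\<in>V. M z y * e y))"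
        by (simp add: sum_distrib_left mult_ac)
      also have "\<dots> = t * (M x x * t)"
        unfolding e_def using V x
        by (simp add: if_distrib[of "\<lambda>w. w * _"] if_distrib[of "\<lambda>w. _ * w"] cong: if_cong)
      finally have Q: "Q (\<lambda>y. f y + e y) = Q f + 2 * t * (\<Sum>z\<in>V. M x z * f z) + t\<^sup>2 * M x x"
        by (simp add: power2_eq_square)
      have "N (\<lambda>y. f y + e y) = N f + 2 * (\<Sum>y\<in>V. e y * f y) + (\<Sum>y\<in>V. e y * e y)"
        unfolding N_def by (simp add: power2_eq_square algebra_simps sum.distrib sum_distrib_left)
      also have "(\<Sum>y\<in>V. e y * f y) = t * f x"
        unfolding e_def using V x by (simp add: if_distrib[of "\<lambda>w. w * _"] cong: if_cong)
      also have "(\<Sum>y\<in>V. e y * e y) = t * t"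
        unfolding e_def using V x
        by (simp add: if_distrib[of "\<lambda>w. w * _"] if_distrib[of "\<lambda>w. _ * w"] cong: if_cong)
      finally show ?thesis
        using Q_ge[of "\<lambda>y. f y + e y"] unfolding Q Nf by (simp add: algebra_simps power2_eq_square)
    qed
    then show ?thesis
      using quadratic_nonneg_imp_linear_zero by fastforce
  qed
  have "\<exists>x\<in>V. f x \<noteq> 0"
  proof (rule ccontr)
    assume "\<not> ?thesis"
    then have "N f = 0" by (simp add: N_def)
    then show False using Nf by simp
  qed
  then show thesis
    by (rule that[of f "Q f"]) (use eig Q_ge in \<open>simp_all add: Q_def N_def\<close>)
qed

section \<open>Neighbourhoods in a slice and their symmetries\<close>

definition slice :: "'a set \<Rightarrow> nat \<Rightarrow> 'a set set" where
  "slice X k = {A. A \<subseteq> X \<and> card A = k}"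

definition nbrs :: "'a set \<Rightarrow> nat \<Rightarrow> nat \<Rightarrow> 'a set \<Rightarrow> 'a set set" where
  "nbrs X k s A = {B \<in> slice X k. card (A \<inter> B) = s}"

lemma finite_slice [simp]: "finite X \<Longrightarrow> finite (slice X k)"
  by (simp add: slice_def)

lemma finite_nbrs [simp]: "finite X \<Longrightarrow> finite (nbrs X k s A)"
  by (simp add: nbrs_def)

lemma card_slice: "finite X \<Longrightarrow> card (slice X k) = card X choose k"
  by (simp add: slice_def n_subsets)

lemma transpose_image_in_slice_iff:
  assumes "p \<in> X" "q \<in> X"
  shows "transpose p q ` A \<in> slice X k \<longleftrightarrow> A \<in> slice X k"
proof -
  have "transpose p q ` A \<subseteq> X \<longleftrightarrow> A \<subseteq> X"
    using assms by (metis image_mono inj_image_subset_iff inj_transpose transpose_image_eq)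
  then show ?thesis by (simp add: slice_def card_image)
qed

lemma transpose_image_exchange:
  assumes "p \<in> A" "q \<notin> A"
  shows "transpose p q ` A = insert q (A - {p})"
  using assms by (auto simp: in_transpose_image_iff transpose_def split: if_splits)

text \<open>Transpositions of points of \<open>X\<close> are automorphisms of the graph, so the
  adjacency operator commutes with them.\<close>

lemma sum_nbrs_transpose:
  assumes "p \<in> X" "q \<in> X"
  shows "(\<Sum>B\<in>nbrs X k s A. f (transpose p q ` B)) = (\<Sum>B\<in>nbrs X k s (transpose p q ` A). f B)"
proof (rule sum.reindex_bij_betw)
  have im: "transpose p q ` B \<in> nbrs X k s (transpose p q ` A)" if "B \<in> nbrs X k s A" for A B
    using that unfolding nbrs_def
    by (simp add: transpose_image_in_slice_iff[OF assms] image_Int[symmetric] card_image)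
  have inv: "transpose p q ` transpose p q ` B = B" for B
    by (simp add: image_comp)
  show "bij_betw ((`) (transpose p q)) (nbrs X k s A) (nbrs X k s (transpose p q ` A))"
    by (rule bij_betw_byWitness[where f' = "(`) (transpose p q)"])
      (use im im[of _ "transpose p q ` A"] in \<open>auto simp: inv\<close>)
qed

text \<open>A neighbour is given by the points \<open>R\<close> leaving \<open>A\<close> and the
  points \<open>S\<close> entering it. The two choices are independent, which turns sums over
  neighbours into double sums.\<close>

lemma bij_betw_nbrs:
  assumes X: "finite X" and A: "A \<in> slice X k" and s: "s \<le> k"
  shows "bij_betw (\<lambda>(R, S). (A - R) \<union> S) (slice A (k - s) \<times> slice (X - A) (k - s)) (nbrs X k s A)"
proof (rule bij_betw_byWitness[where f' = "\<lambda>B. (A - B, B - A)"])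
  have fin: "finite A" and AX: "A \<subseteq> X" and cA: "card A = k"
    using A X finite_subset by (auto simp: slice_def)
  show "\<forall>a\<in>slice A (k - s) \<times> slice (X - A) (k - s).
      (case case a of (R, S) \<Rightarrow> A - R \<union> S of B \<Rightarrow> (A - B, B - A)) = a"
    by (auto simp: slice_def)
  show "\<forall>B\<in>nbrs X k s A. (case (A - B, B - A) of (R, S) \<Rightarrow> A - R \<union> S) = B"
    by (auto simp: nbrs_def slice_def)
  show "(\<lambda>(R, S). (A - R) \<union> S) ` (slice A (k - s) \<times> slice (X - A) (k - s)) \<subseteq> nbrs X k s A"
  proof clarify
    fix R S assume R: "R \<in> slice A (k - s)" and S: "S \<in> slice (X - A) (k - s)"
    have f: "finite R" "finite S" using R S X fin by (auto simp: slice_def dest: finite_subset)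
    have "card (A - R) = s"
      using R s cA f by (subst card_Diff_subset) (auto simp: slice_def)
    moreover have "card (A - R \<union> S) = card (A - R) + card S"
      using R S fin f by (intro card_Un_disjoint) (auto simp: slice_def)
    moreover have "A \<inter> (A - R \<union> S) = A - R" using S by (auto simp: slice_def)
    ultimately show "A - R \<union> S \<in> nbrs X k s A"
      using R S s AX by (auto simp: nbrs_def slice_def)
  qed
  show "(\<lambda>B. (A - B, B - A)) ` nbrs X k s A \<subseteq> slice A (k - s) \<times> slice (X - A) (k - s)"
  proof clarify
    fix B assume B: "B \<in> nbrs X k s A"
    then have fB: "finite B" using X by (auto simp: nbrs_def slice_def dest: finite_subset)
    have "card (A - B) = k - s"
      using B fin cA by (simp add: card_Diff_subset_Int nbrs_def)
    moreover have "card (B - A) = k - s"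
      using B fB by (simp add: card_Diff_subset_Int nbrs_def slice_def Int_commute)
    ultimately show "A - B \<in> slice A (k - s) \<and> B - A \<in> slice (X - A) (k - s)"
      using B by (auto simp: nbrs_def slice_def)
  qed
qed

lemma sum_nbrs:
  assumes "finite X" "A \<in> slice X k" "s \<le> k"
  shows "(\<Sum>B\<in>nbrs X k s A. f B) =
    (\<Sum>R\<in>slice A (k - s). \<Sum>S\<in>slice (X - A) (k - s). f ((A - R) \<union> S))"
  unfolding sum.reindex_bij_betw[OF bij_betw_nbrs[OF assms], symmetric]
  by (simp add: sum.cartesian_product split_def)

lemma card_nbrs:
  assumes "finite X" "A \<in> slice X k" "s \<le> k"
  shows "card (nbrs X k s A) = (k choose (k - s)) * ((card X - k) choose (k - s))"
proof -
  have fin: "finite A" "A \<subseteq> X" "card A = k"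
    using assms finite_subset by (auto simp: slice_def)
  then have "card (X - A) = card X - k" by (simp add: card_Diff_subset)
  with fin assms show ?thesis
    unfolding bij_betw_same_card[OF bij_betw_nbrs[OF assms], symmetric]
    by (simp add: card_cartesian_product card_slice)
qed

text \<open>With the trace on \<open>D\<close> prescribed, only \<open>S - D\<close> is free. For
  \<open>card T > r\<close> the truncated difference would count one set instead of none, hence the
  case distinction.\<close>

lemma card_slice_inter:
  assumes Y: "finite Y" and T: "T \<subseteq> Y \<inter> D"
  shows "card {S \<in> slice Y r. S \<inter> D = T} =
    (if card T \<le> r then (card Y - card (Y \<inter> D)) choose (r - card T) else 0)"
proof -
  have fT: "finite T" using T Y finite_subset by blast
  show ?thesis
  proof (cases "card T \<le> r")
    case True
    have "bij_betw (\<lambda>S. S - D) {S \<in> slice Y r. S \<inter> D = T} (slice (Y - D) (r - card T))"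
    proof (rule bij_betw_byWitness[where f' = "\<lambda>U. U \<union> T"])
      show "(\<lambda>S. S - D) ` {S \<in> slice Y r. S \<inter> D = T} \<subseteq> slice (Y - D) (r - card T)"
      proof clarify
        fix S assume S: "S \<in> slice Y r" "T = S \<inter> D"
        have "finite S" using S Y by (auto simp: slice_def dest: finite_subset)
        then show "S - D \<in> slice (Y - D) (r - card (S \<inter> D))"
          using S by (auto simp: slice_def card_Diff_subset_Int)
      qed
      show "(\<lambda>U. U \<union> T) ` slice (Y - D) (r - card T) \<subseteq> {S \<in> slice Y r. S \<inter> D = T}"
      proof clarify
        fix U assume U: "U \<in> slice (Y - D) (r - card T)"
        have fU: "finite U" using U Y by (auto simp: slice_def dest: finite_subset)
        have "card (U \<union> T) = card U + card T"
          using U T fU fT by (intro card_Un_disjoint) (auto simp: slice_def)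
        then show "U \<union> T \<in> slice Y r \<and> (U \<union> T) \<inter> D = T"
          using U T True by (auto simp: slice_def)
      qed
    qed (use T in \<open>auto simp: slice_def\<close>)
    then have "card {S \<in> slice Y r. S \<inter> D = T} = card (slice (Y - D) (r - card T))"
      by (rule bij_betw_same_card)
    also have "\<dots> = (card Y - card (Y \<inter> D)) choose (r - card T)"
      using Y by (simp add: card_slice card_Diff_subset_Int)
    finally show ?thesis using True by simp
  next
    case False
    have "S \<inter> D \<noteq> T" if "S \<in> slice Y r" for S
    proof
      assume "S \<inter> D = T"
      then have "card T \<le> card S"
        using that Y by (intro card_mono) (auto simp: slice_def dest: finite_subset)
      with False that show False by (simp add: slice_def)
    qed
    then have "{S \<in> slice Y r. S \<inter> D = T} = {}" by blast
    then have "card {S \<in> slice Y r. S \<inter> D = T} = 0" by (simp only: card.empty)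
    then show ?thesis using False by (simp only: if_False)
  qed
qed

lemma sum_Pow_card:
  fixes g :: "nat \<Rightarrow> real"
  assumes "finite P"
  shows "(\<Sum>T\<in>Pow P. g (card T)) = (\<Sum>i\<le>card P. real (card P choose i) * g i)"
proof -
  have "(\<Sum>T\<in>Pow P. g (card T)) = (\<Sum>i\<le>card P. \<Sum>T\<in>{T \<in> Pow P. card T = i}. g (card T))"
    using assms by (intro sum.group[symmetric]) (auto intro: card_mono)
  also have "\<dots> = (\<Sum>i\<le>card P. real (card P choose i) * g i)"
    using assms by (intro sum.cong refl) (simp add: n_subsets[symmetric])
  finally show ?thesis .
qed

section \<open>Eigenfunctions antisymmetric in pairs of points\<close>

text \<open>A function on the slice is described by the involution \<open>\<tau>\<close> pairing up the moved points \<open>D\<close>: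
  it changes sign when a pair is swapped and is symmetric in the remaining points.\<close>

locale johnson_eigenfunction =
  fixes X :: "'a set" and k :: nat and D :: "'a set" and \<tau> :: "'a \<Rightarrow> 'a" and f :: "'a set \<Rightarrow> real"
  assumes fin: "finite X" and invol: "\<And>x. \<tau> (\<tau> x) = x" and D: "D = {x. \<tau> x \<noteq> x}" and DX: "D \<subseteq> X"
    and anti: "\<And>x A. x \<in> D \<Longrightarrow> A \<in> slice X k \<Longrightarrow> f (transpose x (\<tau> x) ` A) = - f A"
    and symm: "\<And>p q A. p \<in> X - D \<Longrightarrow> q \<in> X - D \<Longrightarrow> A \<in> slice X k \<Longrightarrow> f (transpose p q ` A) = f A"
begin

lemma tau_in_D: "x \<in> D \<Longrightarrow> \<tau> x \<in> D"
  using D invol by force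

lemma inj_tau: "inj_on \<tau> S"
  by (metis inj_onI invol)

text \<open>A set containing both or neither of \<open>x\<close> and \<open>\<tau> x\<close> is
  fixed by their swap, so \<open>f\<close> equals its own negative there. The support thus consists
  of sets meeting every pair in one point.\<close>

lemma splits:
  assumes "A \<in> slice X k" "f A \<noteq> 0" "x \<in> D"
  shows "\<tau> x \<in> A \<longleftrightarrow> x \<notin> A"
proof (rule ccontr)
  assume "\<not> ?thesis"
  then have "transpose x (\<tau> x) ` A = A" by (intro transpose_image_eq) auto
  then show False using anti[of x A] assms by simp
qed

text \<open>Sets of equal size and equal trace on \<open>D\<close> are joined by exchanges of points
  outside \<open>D\<close>, each of which preserves \<open>f\<close>.\<close>

lemma eq_if_same_trace:
  assumes "A \<in> slice X k" "B \<in> slice X k" "A \<inter> D = B \<inter> D"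
  shows "f A = f B"
  using assms
proof (induction "card (A - B)" arbitrary: A)
  case 0
  have fA: "finite A" "finite B" using 0 fin by (auto simp: slice_def dest: finite_subset)
  then have "A \<subseteq> B" using 0 by auto
  then have "A = B" using 0 fA by (intro card_subset_eq) (auto simp: slice_def)
  then show ?case by simp
next
  case (Suc m)
  have fA: "finite A" "finite B" using Suc.prems fin by (auto simp: slice_def dest: finite_subset)
  obtain p where p: "p \<in> A - B" using Suc.hyps(2) by (metis card.empty equals0I nat.simps(3))
  have "card (B - A) = card (A - B)"
    using Suc.prems fA by (simp add: card_Diff_subset_Int slice_def Int_commute)
  then obtain q where q: "q \<in> B - A" using Suc.hyps(2) by (metis card.empty equals0I nat.simps(3))
  have pq: "p \<in> X - D" "q \<in> X - D"
    using p q Suc.prems by (auto simp: slice_def)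
  let ?A = "transpose p q ` A"
  have eq: "?A = insert q (A - {p})"
    using p q by (intro transpose_image_exchange) auto
  have "?A - B = A - B - {p}" unfolding eq using q by auto
  then have "m = card (?A - B)" using Suc.hyps(2) p fA by simp
  moreover have "?A \<in> slice X k"
    using pq Suc.prems by (simp add: transpose_image_in_slice_iff)
  moreover have "?A \<inter> D = B \<inter> D" unfolding eq using p q Suc.prems(3) by auto
  ultimately have "f ?A = f B" using Suc.hyps(1) Suc.prems(2) by blast
  then show ?case using symm[OF pq Suc.prems(1)] by simp
qed

text \<open>By \<open>splits\<close> the partners of \<open>T\<close> lie outside \<open>A\<close>,
  so the pairs can be swapped one at a time, with one sign change each.\<close>

lemma swap_pairs:
  assumes A: "A \<in> slice X k" "f A \<noteq> 0" and T: "T \<subseteq> A \<inter> D"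
  shows "(A - T) \<union> \<tau> ` T \<in> slice X k \<and> f ((A - T) \<union> \<tau> ` T) = (-1) ^ card T * f A"
proof -
  have "finite T" using T A fin by (auto simp: slice_def dest: finite_subset)
  then show ?thesis using T
  proof (induction T rule: finite_induct)
    case (insert x T)
    let ?B = "(A - T) \<union> \<tau> ` T"
    have out: "\<tau> y \<notin> A" if "y \<in> insert x T" for y
      using splits[OF A, of y] that insert.prems by auto
    have x: "x \<in> D" "x \<in> X" "\<tau> x \<in> X" using insert.prems tau_in_D DX by auto
    have "x \<in> ?B" using insert by auto
    moreover have "\<tau> x \<notin> ?B" using out[of x] insert.hyps(2) invol by (auto dest: arg_cong[of _ _ \<tau>])
    ultimately have "transpose x (\<tau> x) ` ?B = insert (\<tau> x) (?B - {x})"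
      by (rule transpose_image_exchange)
    also have "\<dots> = (A - insert x T) \<union> \<tau> ` insert x T"
      using out insert.prems insert.hyps by auto
    finally have eq: "transpose x (\<tau> x) ` ?B = (A - insert x T) \<union> \<tau> ` insert x T" .
    have "?B \<in> slice X k" "f ?B = (-1) ^ card T * f A" using insert by auto
    then show ?case
      unfolding eq[symmetric] using anti[OF x(1)] x insert.hyps
      by (simp add: transpose_image_in_slice_iff)
  qed (use A in simp)
qed

text \<open>The equation is evaluated at one \<open>A\<close> in the support, where \<open>j\<close>
  counts the pairs. A neighbour contributes only if the points of \<open>D\<close> that enter are
  the partners of those that leave, and then with sign \<open>(-1) ^ i\<close> for \<open>i\<close>
  such points. They are chosen in \<open>j choose i\<close> ways; the other \<open>r - i\<close>
  leaving and entering points come from \<open>k - j\<close> and \<open>card X - k - j\<close>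
  points, which gives the formula for \<open>\<lambda>_j\<close>.\<close>

lemma eigenvalue:
  assumes A: "A \<in> slice X k" "f A \<noteq> 0" and s: "s \<le> k"
    and ev: "(\<Sum>B\<in>nbrs X k s A. f B) = \<mu> * f A"
  shows "\<exists>j. j \<le> k \<and> j \<le> card X - k \<and> \<mu> = johnson_ev k (card X - k) (k - s) j"
proof -
  define r where "r = k - s"
  define P where "P = A \<inter> D"
  define j where "j = card P"
  define Y where "Y = X - A"
  have fA: "finite A" "A \<subseteq> X" "card A = k" using A fin by (auto simp: slice_def dest: finite_subset)
  have Y: "finite Y" "card Y = card X - k" unfolding Y_def using fA fin by (auto simp: card_Diff_subset)
  have fP: "finite P" using fA by (simp add: P_def)
  have YD: "Y \<inter> D = \<tau> ` P"
  proof
    show "\<tau> ` P \<subseteq> Y \<inter> D"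
      using splits[OF A] tau_in_D DX by (auto simp: P_def Y_def)
    show "Y \<inter> D \<subseteq> \<tau> ` P"
    proof
      fix y assume "y \<in> Y \<inter> D"
      then have "\<tau> y \<in> P" using splits[OF A] tau_in_D by (auto simp: P_def Y_def)
      then show "y \<in> \<tau> ` P" by (metis imageI invol)
    qed
  qed
  have cYD: "card (Y \<inter> D) = j" unfolding YD j_def by (simp add: card_image inj_tau)
  have jk: "j \<le> k" unfolding j_def P_def fA(3)[symmetric] using fA by (intro card_mono) auto
  have jY: "j \<le> card X - k" unfolding cYD[symmetric] Y(2)[symmetric] using Y by (intro card_mono) auto
  have val: "f ((A - R) \<union> S) = (if S \<inter> D = \<tau> ` (R \<inter> D) then (-1) ^ card (R \<inter> D) * f A else 0)"
    if R: "R \<in> slice A r" and S: "S \<in> slice Y r" for R S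
  proof -
    let ?B = "(A - R) \<union> S"
    have "?B \<in> nbrs X k s A"
      using bij_betw_nbrs[OF fin A(1) s] R S unfolding bij_betw_def r_def Y_def by auto
    then have B: "?B \<in> slice X k" by (simp add: nbrs_def)
    have RA: "R \<subseteq> A" and SY: "S \<subseteq> Y" using R S by (auto simp: slice_def)
    show ?thesis
    proof (cases "S \<inter> D = \<tau> ` (R \<inter> D)")
      case True
      have T: "R \<inter> D \<subseteq> A \<inter> D" using RA by auto
      have "?B \<inter> D = ((A - (R \<inter> D)) \<union> \<tau> ` (R \<inter> D)) \<inter> D"
        using True tau_in_D by auto
      then have "f ?B = f ((A - (R \<inter> D)) \<union> \<tau> ` (R \<inter> D))"
        using swap_pairs[OF A T] B by (intro eq_if_same_trace) auto
      then show ?thesis using swap_pairs[OF A T] True by simp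
    next
      case False
      have "S \<inter> D = \<tau> ` (R \<inter> D)" if nz: "f ?B \<noteq> 0"
      proof -
        have iff: "\<tau> x \<in> S \<longleftrightarrow> x \<in> R" if x: "x \<in> P" for x
        proof -
          have "x \<in> A" "x \<in> D" "\<tau> x \<notin> A" "x \<notin> S"
            using x splits[OF A] SY by (auto simp: P_def Y_def)
          then show ?thesis using splits[OF B nz, of x] by auto
        qed
        have "S \<inter> D \<subseteq> \<tau> ` P" using SY YD by auto
        then show ?thesis
          using iff tau_in_D RA by (auto simp: P_def)
      qed
      then show ?thesis using False by auto
    qed
  qed
  define g where "g i = (-1) ^ i * (if i \<le> r then real ((card X - k - j) choose (r - i)) else 0)" for i
  have inner: "(\<Sum>S\<in>slice Y r. f ((A - R) \<union> S)) = g (card (R \<inter> D)) * f A" if R: "R \<in> slice A r" for R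
  proof -
    have RP: "R \<inter> D \<subseteq> P" using R by (auto simp: slice_def P_def)
    have ci: "card (\<tau> ` (R \<inter> D)) = card (R \<inter> D)" by (simp add: card_image inj_tau)
    have "(\<Sum>S\<in>slice Y r. f ((A - R) \<union> S)) =
       (\<Sum>S\<in>slice Y r. if S \<inter> D = \<tau> ` (R \<inter> D) then (-1) ^ card (R \<inter> D) * f A else 0)"
      using val[OF R] by (intro sum.cong) auto
    also have "\<dots> = (\<Sum>S\<in>{S \<in> slice Y r. S \<inter> D = \<tau> ` (R \<inter> D)}. (-1) ^ card (R \<inter> D) * f A)"
      using Y by (intro sum.inter_filter[symmetric]) auto
    also have "\<dots> = real (card {S \<in> slice Y r. S \<inter> D = \<tau> ` (R \<inter> D)}) * ((-1) ^ card (R \<inter> D) * f A)"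
      by simp
    also have "card {S \<in> slice Y r. S \<inter> D = \<tau> ` (R \<inter> D)} =
        (if card (R \<inter> D) \<le> r then (card X - k - j) choose (r - card (R \<inter> D)) else 0)"
      using card_slice_inter[of Y "\<tau> ` (R \<inter> D)" D r] image_mono[OF RP, of \<tau>]
      unfolding YD[symmetric] cYD ci Y(2) using Y(1) by blast
    finally show ?thesis by (simp add: g_def)
  qed
  have "\<mu> * f A = (\<Sum>R\<in>slice A r. \<Sum>S\<in>slice Y r. f ((A - R) \<union> S))"
    unfolding ev[symmetric] sum_nbrs[OF fin A(1) s] r_def Y_def ..
  also have "\<dots> = (\<Sum>R\<in>slice A r. g (card (R \<inter> D))) * f A"
    using inner by (simp add: sum_distrib_right)
  also have "(\<Sum>R\<in>slice A r. g (card (R \<inter> D))) =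
      (\<Sum>T\<in>Pow P. \<Sum>R\<in>{R \<in> slice A r. R \<inter> D = T}. g (card (R \<inter> D)))"
    using fA fP by (intro sum.group[symmetric]) (auto simp: P_def slice_def)
  also have "\<dots> = (\<Sum>T\<in>Pow P. g (card T) * (if card T \<le> r then real ((k - j) choose (r - card T)) else 0))"
  proof (rule sum.cong[OF refl])
    fix T assume "T \<in> Pow P"
    then have "card {R \<in> slice A r. R \<inter> D = T} =
        (if card T \<le> r then (k - j) choose (r - card T) else 0)"
      using card_slice_inter[of A T D r] fA by (auto simp: P_def j_def)
    moreover have "(\<Sum>R\<in>{R \<in> slice A r. R \<inter> D = T}. g (card (R \<inter> D))) =
      real (card {R \<in> slice A r. R \<inter> D = T}) * g (card T)"
      by simp
    ultimately show "(\<Sum>R\<in>{R \<in> slice A r. R \<inter> D = T}. g (card (R \<inter> D))) =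
       g (card T) * (if card T \<le> r then real ((k - j) choose (r - card T)) else 0)"
      by simp
  qed
  also have "\<dots> = johnson_ev k (card X - k) r j"
    unfolding johnson_ev_def g_def j_def

    by (subst sum_Pow_card[OF fP, of "\<lambda>i. (-1) ^ i * (if i \<le> r then real ((card X - k - card P) choose (r - i)) else 0) * (if i \<le> r then real ((k - card P) choose (r - i)) else 0)"])
      (intro sum.cong refl; simp)
  finally have "\<mu> = johnson_ev k (card X - k) r j" using A by simp
  then show ?thesis using jk jY unfolding r_def by blast
qed

end

text \<open>The eigenspace is invariant under permutations; antisymmetrising an eigenfunction in as many
  disjoint pairs of points as possible leaves one that is symmetric in the other points.\<close>

lemma johnson_eigenvalue_cases:
  fixes f :: "'a set \<Rightarrow> real"
  assumes fin: "finite X" and s: "s \<le> k"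
    and nz: "\<exists>A\<in>slice X k. f A \<noteq> 0"
    and ev: "\<And>A. A \<in> slice X k \<Longrightarrow> (\<Sum>B\<in>nbrs X k s A. f B) = \<mu> * f A"
  shows "\<exists>j. j \<le> k \<and> j \<le> card X - k \<and> \<mu> = johnson_ev k (card X - k) (k - s) j"
proof -
  let ?V = "slice X k"
  define D where "D \<tau> = {x. \<tau> x \<noteq> x}" for \<tau> :: "'a \<Rightarrow> 'a"
  \<comment> \<open>States of the antisymmetrisation: the pairing so far and an eigenfunction
    antisymmetric in it. \<open>(id, f)\<close> has no pairs, and the moved points lie in
    \<open>X\<close>, so a state moving the most points exists.\<close>
  define W where "W = (\<lambda>(\<tau>, g :: 'a set \<Rightarrow> real). (\<forall>x. \<tau> (\<tau> x) = x) \<and> D \<tau> \<subseteq> X \<and> (\<exists>A\<in>?V. g A \<noteq> 0)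
    \<and> (\<forall>A\<in>?V. (\<Sum>B\<in>nbrs X k s A. g B) = \<mu> * g A)
    \<and> (\<forall>x\<in>D \<tau>. \<forall>A\<in>?V. g (transpose x (\<tau> x) ` A) = - g A))"
  have "W (id, f)" using nz ev by (auto simp: W_def D_def)
  moreover have "\<forall>y. W y \<longrightarrow> card (D (fst y)) < Suc (card X)"
    using fin by (auto simp: W_def intro: card_mono le_imp_less_Suc)
  ultimately obtain y where "W y" and y_max: "\<And>z. W z \<Longrightarrow> card (D (fst z)) \<le> card (D (fst y))"
    using ex_has_greatest_nat[of W "(id, f)" "\<lambda>y. card (D (fst y))" "Suc (card X)"] by blast
  then obtain \<tau> g where W: "W (\<tau>, g)" and max: "\<And>\<tau>' g'. W (\<tau>', g') \<Longrightarrow> card (D \<tau>') \<le> card (D \<tau>)"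
    by (cases y) force
  have invol: "\<tau> (\<tau> x) = x" for x using W by (simp add: W_def)
  have DX: "D \<tau> \<subseteq> X" using W by (simp add: W_def)
  have fD: "finite (D \<tau>)" using DX fin finite_subset by blast
  have ev_g: "(\<Sum>B\<in>nbrs X k s A. g B) = \<mu> * g A" if "A \<in> ?V" for A using W that by (simp add: W_def)
  have anti: "g (transpose x (\<tau> x) ` A) = - g A" if "x \<in> D \<tau>" "A \<in> ?V" for x A
    using W that by (auto simp: W_def)
  have symm: "g (transpose p q ` A) = g A" if pq: "p \<in> X - D \<tau>" "q \<in> X - D \<tau>" and A: "A \<in> ?V" for p q A
  proof (rule ccontr)
    assume neq: "g (transpose p q ` A) \<noteq> g A"
    then have ne: "p \<noteq> q" by auto
    let ?t = "\<lambda>A. transpose p q ` A"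
    define \<tau>' where "\<tau>' = \<tau>(p := q, q := p)"
    \<comment> \<open>If symmetry fails, \<open>g'\<close> is a nonzero eigenfunction, antisymmetric
      in the new pair. The old antisymmetries survive because transpositions with disjoint supports
      commute, so two more points are moved, against maximality.\<close>
    define g' where "g' A = g A - g (?t A)" for A
    have fix_pq: "\<tau> p = p" "\<tau> q = q" using pq by (auto simp: D_def)
    have off: "\<tau> x \<noteq> p" "\<tau> x \<noteq> q" if "x \<noteq> p" "x \<noteq> q" for x
      using that fix_pq invol by metis+
    have D': "D \<tau>' = insert p (insert q (D \<tau>))"
      using ne by (auto simp: D_def \<tau>'_def)
    have tV: "?t A \<in> ?V \<longleftrightarrow> A \<in> ?V" for A using pq by (intro transpose_image_in_slice_iff) auto
    have tt: "?t (?t A) = A" for A by (simp add: image_comp)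
    have "W (\<tau>', g')"
      unfolding W_def prod.case
    proof (intro conjI)
      show "\<forall>x. \<tau>' (\<tau>' x) = x"
        using off invol by (auto simp: \<tau>'_def)
      show "D \<tau>' \<subseteq> X" unfolding D' using DX pq by auto
      show "\<exists>A\<in>?V. g' A \<noteq> 0" using A neq by (intro bexI[of _ A]) (auto simp: g'_def)
      show "\<forall>A\<in>?V. (\<Sum>B\<in>nbrs X k s A. g' B) = \<mu> * g' A"
      proof
        fix A assume A: "A \<in> ?V"
        have "(\<Sum>B\<in>nbrs X k s A. g (?t B)) = (\<Sum>B\<in>nbrs X k s (?t A). g B)"
          using pq by (intro sum_nbrs_transpose) auto
        also have "\<dots> = \<mu> * g (?t A)" using A tV by (intro ev_g) simp
        finally show "(\<Sum>B\<in>nbrs X k s A. g' B) = \<mu> * g' A"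
          using ev_g[OF A] by (simp add: g'_def sum_subtractf algebra_simps)
      qed
      show "\<forall>x\<in>D \<tau>'. \<forall>A\<in>?V. g' (transpose x (\<tau>' x) ` A) = - g' A"
      proof (intro ballI)
        fix x A assume x: "x \<in> D \<tau>'" and A: "A \<in> ?V"
        show "g' (transpose x (\<tau>' x) ` A) = - g' A"
        proof (cases "x = p \<or> x = q")
          case True
          then have "transpose x (\<tau>' x) = transpose p q"
            using ne by (auto simp: \<tau>'_def transpose_commute)
          then show ?thesis by (simp add: g'_def tt)
        next
          case False
          then have xD: "x \<in> D \<tau>" and \<tau>x: "\<tau>' x = \<tau> x" using x unfolding D' by (auto simp: \<tau>'_def)
          have "transpose p q \<circ> transpose x (\<tau> x) = transpose x (\<tau> x) \<circ> transpose p q"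
            using False off[of x] by (auto simp: fun_eq_iff transpose_def)
          then have comm: "?t (transpose x (\<tau> x) ` A) = transpose x (\<tau> x) ` ?t A"
            by (simp add: image_comp)
          show ?thesis
            unfolding \<tau>x g'_def comm using anti[OF xD] A tV by simp
        qed
      qed
    qed
    then have "card (D \<tau>') \<le> card (D \<tau>)" by (rule max)
    moreover have "card (D \<tau>') = card (D \<tau>) + 2"
      unfolding D' using pq ne fD by simp
    ultimately show False by simp
  qed
  interpret johnson_eigenfunction X k "D \<tau>" \<tau> g
    by unfold_locales (fact fin invol D_def DX anti symm)+
  obtain A where A: "A \<in> ?V" "g A \<noteq> 0" using W by (auto simp: W_def)
  show ?thesis by (rule eigenvalue[OF A s ev_g[OF A(1)]])
qed

section \<open>Quantum colourings\<close>

lemma finsum_ring_mat: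
  assumes "finite I" "\<And>i. i \<in> I \<Longrightarrow> F i \<in> carrier_mat m m"
  shows "finsum (ring_mat TYPE('a :: comm_ring_1) m ()) F I \<in> carrier_mat m m \<and>
    (\<forall>x<m. \<forall>y<m. finsum (ring_mat TYPE('a) m ()) F I $$ (x, y) = (\<Sum>i\<in>I. F i $$ (x, y)))"
proof -
  interpret R: ring "ring_mat TYPE('a) m ()" by (rule ring_mat)
  show ?thesis
    using assms
  proof (induction I rule: finite_induct)
    case empty
    then show ?case by (simp add: ring_mat_simps)
  next
    case (insert i I)
    then have "finsum (ring_mat TYPE('a) m ()) F (insert i I) = F i + finsum (ring_mat TYPE('a) m ()) F I"
      by (subst R.finsum_insert) (auto simp: ring_mat_simps)
    then show ?case using insert by auto
  qed
qed

lemma mat_adjoint_index: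
  assumes "A \<in> carrier_mat m m" "x < m" "y < m"
  shows "mat_adjoint A $$ (x, y) = cnj (A $$ (y, x))"
  using assms by (simp add: mat_adjoint_def mat_of_rows_def)

text \<open>The real and imaginary parts of the entries of \<open>c P\<^sub>v\<^sub>\<alpha> - I\<close>, as functions of \<open>v\<close>, are the test
  vectors for the quadratic form.\<close>

lemma quantum_coloring_hoffman:
  fixes G :: "'a pair_pre_digraph" and nb :: "'a \<Rightarrow> 'a set"
  assumes col: "quantum_coloring G c m P"
    and V: "finite (pverts G)" "pverts G \<noteq> {}"
    and nb: "\<And>u v. u \<in> pverts G \<Longrightarrow> v \<in> nb u \<Longrightarrow> v \<in> pverts G \<and> (u, v) \<in> parcs G"
    and deg: "\<And>u. u \<in> pverts G \<Longrightarrow> card (nb u) = d"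
    and form: "\<And>g. \<mu> * (\<Sum>u\<in>pverts G. (g u)\<^sup>2) \<le> (\<Sum>u\<in>pverts G. \<Sum>v\<in>nb u. g u * g v)"
  shows "real d \<le> - \<mu> * (real c - 1)"
proof -
  let ?V = "pverts G"
  have c: "c > 0" and m: "m > 0"
    and proj: "\<And>v \<alpha>. v \<in> ?V \<Longrightarrow> \<alpha> \<in> {1..c} \<Longrightarrow> hermitian_projector m (P v \<alpha>)"
    and sum1: "\<And>v. v \<in> ?V \<Longrightarrow> finsum (ring_mat TYPE(complex) m ()) (P v) {1..c} = 1\<^sub>m m"
    and edge: "\<And>u v \<alpha>. (u, v) \<in> parcs G \<Longrightarrow> \<alpha> \<in> {1..c} \<Longrightarrow> P u \<alpha> * P v \<alpha> = 0\<^sub>m m m"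
    using col unfolding quantum_coloring_def by blast+
  have car: "P v \<alpha> \<in> carrier_mat m m" if "v \<in> ?V" "\<alpha> \<in> {1..c}" for v \<alpha>
    using proj[OF that] by (simp add: hermitian_projector_def)
  have herm: "cnj (P v \<alpha> $$ (x, y)) = P v \<alpha> $$ (y, x)" if "v \<in> ?V" "\<alpha> \<in> {1..c}" "x < m" "y < m" for v \<alpha> x y
    using proj[OF that(1,2)] mat_adjoint_index[of "P v \<alpha>" m y x] that by (simp add: hermitian_projector_def)
  \<comment> \<open>Subtracting the identity removes the common component of the vectors
    \<open>c P\<close>. The inner products become \<open>cm(c - 1)\<close> of a vertex with itself
    and \<open>-cm\<close> along edges, as for the corners of a regular simplex, whatever the
    colouring.\<close>
  define Z where "Z v \<alpha> x y = of_nat c * P v \<alpha> $$ (x, y) - (if x = y then 1 else 0)" for v \<alpha> x y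
  define S where "S h = (\<Sum>\<alpha>\<in>{1..c}. \<Sum>x<m. \<Sum>y<m. h \<alpha> x y)" for h :: "nat \<Rightarrow> nat \<Rightarrow> nat \<Rightarrow> complex"
  define ip where "ip u v = Re (S (\<lambda>\<alpha> x y. Z u \<alpha> x y * cnj (Z v \<alpha> x y)))" for u v
  have diag: "(\<Sum>\<alpha>\<in>{1..c}. \<Sum>x<m. P v \<alpha> $$ (x, x)) = of_nat m" if v: "v \<in> ?V" for v
  proof -
    have "(\<Sum>\<alpha>\<in>{1..c}. \<Sum>x<m. P v \<alpha> $$ (x, x)) = (\<Sum>x<m. \<Sum>\<alpha>\<in>{1..c}. P v \<alpha> $$ (x, x))"
      by (rule sum.swap)
    also have "\<dots> = (\<Sum>x<m. 1\<^sub>m m $$ (x, x))"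
    proof (rule sum.cong[OF refl])
      fix x assume "x \<in> {..<m}"
      then show "(\<Sum>\<alpha>\<in>{1..c}. P v \<alpha> $$ (x, x)) = 1\<^sub>m m $$ (x, x)"
        using finsum_ring_mat[of "{1..c}" "P v" m] car[OF v] unfolding sum1[OF v]
          by (metis finite_atLeastAtMost lessThan_iff)
    qed
    finally show ?thesis by simp
  qed
  have tr: "S (\<lambda>\<alpha> x y. P u \<alpha> $$ (x, y) * P v \<alpha> $$ (y, x)) = (\<Sum>\<alpha>\<in>{1..c}. \<Sum>x<m. (P u \<alpha> * P v \<alpha>) $$ (x, x))"
    if "u \<in> ?V" "v \<in> ?V" for u v
    unfolding S_def using car that
    by (intro sum.cong refl) (auto simp: scalar_prod_def atLeast0LessThan carrier_matD[OF car])
  have ip_tr: "ip u v = (real c)\<^sup>2 * Re (\<Sum>\<alpha>\<in>{1..c}. \<Sum>x<m. (P u \<alpha> * P v \<alpha>) $$ (x, x)) - real c * real m"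
    if uv: "u \<in> ?V" "v \<in> ?V" for u v
  proof -
    have "S (\<lambda>\<alpha> x y. Z u \<alpha> x y * cnj (Z v \<alpha> x y)) =
      S (\<lambda>\<alpha> x y. (of_nat c)\<^sup>2 * (P u \<alpha> $$ (x, y) * P v \<alpha> $$ (y, x))
        - of_nat c * (if x = y then P u \<alpha> $$ (x, x) else 0)
        - of_nat c * (if x = y then P v \<alpha> $$ (x, x) else 0) + (if x = y then 1 else 0))"
      unfolding S_def Z_def using herm[OF uv(2)]
      by (intro sum.cong refl) (auto simp: algebra_simps power2_eq_square)
    also have "\<dots> = (of_nat c)\<^sup>2 * S (\<lambda>\<alpha> x y. P u \<alpha> $$ (x, y) * P v \<alpha> $$ (y, x))
        - of_nat c * (\<Sum>\<alpha>\<in>{1..c}. \<Sum>x<m. P u \<alpha> $$ (x, x))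
        - of_nat c * (\<Sum>\<alpha>\<in>{1..c}. \<Sum>x<m. P v \<alpha> $$ (x, x)) + of_nat c * of_nat m"
      unfolding S_def by (simp add: sum.distrib sum_subtractf sum_distrib_left[symmetric])
    finally show ?thesis
      unfolding ip_def diag[OF uv(1)] diag[OF uv(2)] tr[OF uv] by (simp flip: of_nat_power)
  qed
  have ip_self: "ip v v = (real c)\<^sup>2 * real m - real c * real m" if v: "v \<in> ?V" for v
  proof -
    have "P v \<alpha> * P v \<alpha> = P v \<alpha>" if "\<alpha> \<in> {1..c}" for \<alpha>
      using proj[OF v that] by (simp add: hermitian_projector_def)
    then show ?thesis unfolding ip_tr[OF v v] using diag[OF v] by simp
  qed
  have ip_edge: "ip u v = - real c * real m" if "u \<in> ?V" "v \<in> nb u" for u v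
    unfolding ip_tr[OF that(1) conjunct1[OF nb[OF that]]] using edge[OF conjunct2[OF nb[OF that]]] by simp
  have "\<mu> * (\<Sum>u\<in>?V. ip u u) \<le> (\<Sum>u\<in>?V. \<Sum>v\<in>nb u. ip u v)"
  proof -
    define I where "I = {1..c} \<times> {..<m} \<times> {..<m}"
    define X Y where "X t v = Re (Z v (fst t) (fst (snd t)) (snd (snd t)))"
      and "Y t v = Im (Z v (fst t) (fst (snd t)) (snd (snd t)))" for t v
    have ip_expand: "ip u v = (\<Sum>t\<in>I. X t u * X t v + Y t u * Y t v)" for u v
      by (simp add: ip_def S_def sum.cartesian_product split_def I_def X_def Y_def)
    have "\<mu> * (\<Sum>u\<in>?V. ip u u) = \<mu> * (\<Sum>t\<in>I. \<Sum>u\<in>?V. X t u * X t u + Y t u * Y t u)"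
      unfolding ip_expand by (subst sum.swap) (rule refl)
    also have "\<dots> = (\<Sum>t\<in>I. \<mu> * (\<Sum>u\<in>?V. (X t u)\<^sup>2) + \<mu> * (\<Sum>u\<in>?V. (Y t u)\<^sup>2))"
      by (simp add: sum_distrib_left sum.distrib power2_eq_square distrib_left)
    also have "\<dots> \<le> (\<Sum>t\<in>I. (\<Sum>u\<in>?V. \<Sum>v\<in>nb u. X t u * X t v) + (\<Sum>u\<in>?V. \<Sum>v\<in>nb u. Y t u * Y t v))"
      by (intro sum_mono add_mono form)
    also have "\<dots> = (\<Sum>t\<in>I. \<Sum>u\<in>?V. \<Sum>v\<in>nb u. X t u * X t v + Y t u * Y t v)"
      by (simp add: sum.distrib)
    also have "\<dots> = (\<Sum>u\<in>?V. \<Sum>v\<in>nb u. ip u v)"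
      unfolding ip_expand by (subst sum.swap, intro sum.cong refl) (rule sum.swap)
    finally show ?thesis .
  qed
  also have "(\<Sum>u\<in>?V. \<Sum>v\<in>nb u. ip u v) = (\<Sum>u\<in>?V. \<Sum>v\<in>nb u. - real c * real m)"
    using ip_edge by (intro sum.cong) auto
  also have "\<dots> = (real (card ?V) * real c * real m) * (- real d)"
    using deg by simp
  also have "\<mu> * (\<Sum>u\<in>?V. ip u u) = (real (card ?V) * real c * real m) * (\<mu> * (real c - 1))"
  proof -
    have "(\<Sum>u\<in>?V. ip u u) = (\<Sum>u\<in>?V. (real c)\<^sup>2 * real m - real c * real m)"
      using ip_self by (intro sum.cong) auto
    also have "\<dots> = real (card ?V) * real c * real m * (real c - 1)"
      by (simp add: power2_eq_square algebra_simps)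
    finally show ?thesis by (simp only: mult_ac)
  qed
  finally have "(real (card ?V) * real c * real m) * (\<mu> * (real c - 1)) \<le> (real (card ?V) * real c * real m) * (- real d)" .
  moreover have "real (card ?V) * real c * real m > 0"
    using c m V by (simp add: card_gt_0_iff)
  ultimately have "\<mu> * (real c - 1) \<le> - real d"
    by (simp only: mult_le_cancel_left_pos)
  then show ?thesis by simp
qed

section \<open>Colourings from characters and sign vectors\<close>

lemma sum_cis_root_of_unity:
  fixes d :: int
  assumes "n > 0" "\<not> int n dvd d"
  shows "(\<Sum>i<n. cis (2 * pi * of_int d / real n) ^ i) = 0"
proof -
  let ?z = "cis (2 * pi * of_int d / real n)"
  have "?z ^ n = cis (2 * pi * of_int d)"
    using assms by (simp add: DeMoivre)
  also have "\<dots> = 1" by (simp add: cis_multiple_2pi)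
  finally have zn: "?z ^ n = 1" .
  have "?z \<noteq> 1"
  proof
    assume "?z = 1"
    then have "cos (2 * pi * of_int d / real n) = 1" by (metis cis.sel(1) one_complex.sel(1))
    then obtain k :: int where "2 * pi * of_int d / real n = of_int k * 2 * pi"
      by (auto simp: cos_one_2pi_int)
    then have "of_int d = (of_int (k * int n) :: real)"
      using assms(1) by (simp add: field_simps)
    then have "d = k * int n" by (simp only: of_int_eq_iff)
    with assms(2) show False by simp
  qed
  then show ?thesis using zn by (simp add: geometric_sum)
qed

text \<open>\<open>P v \<alpha>\<close> projects onto the line of the signed character
  \<open>w v \<alpha>\<close>. At one vertex the signs square away and orthogonality of characters
  remains; for one colour on an edge the characters cancel and orthogonality of the sign vectors
  remains.\<close>

lemma quantum_coloring_of_signs: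
  fixes G :: "'a pair_pre_digraph" and \<sigma> :: "'a \<Rightarrow> nat \<Rightarrow> real"
  assumes n: "n > 0"
    and arcs: "\<And>u v. (u, v) \<in> parcs G \<Longrightarrow> u \<in> pverts G \<and> v \<in> pverts G"
    and sq: "\<And>v i. i < n \<Longrightarrow> (\<sigma> v i)\<^sup>2 = 1"
    and orth: "\<And>u v. (u, v) \<in> parcs G \<Longrightarrow> (\<Sum>i<n. \<sigma> u i * \<sigma> v i) = 0"
  shows "\<exists>P. quantum_coloring G n n P"
proof -
  define e where "e \<alpha> i = cis (2 * pi * real \<alpha> * real i / real n)" for \<alpha> i :: nat
  \<comment> \<open>The same exponential read as a power in the position \<open>i\<close> and in the
    colour \<open>\<alpha>\<close>: the first gives orthogonality, the second completeness.\<close>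
  have ee: "e \<alpha> i * cnj (e \<beta> i) = cis (2 * pi * of_int (int \<alpha> - int \<beta>) / real n) ^ i"
    "e \<alpha> i * cnj (e \<alpha> j) = cis (2 * pi * of_int (int i - int j) / real n) ^ \<alpha>" for \<alpha> \<beta> i j
    unfolding e_def DeMoivre cis_cnj cis_mult by (simp_all add: diff_divide_distrib algebra_simps)
  have ee1: "cnj (e \<alpha> i) * e \<alpha> i = 1" for \<alpha> i
    unfolding e_def cis_cnj cis_mult by simp
  have ndvd: "\<not> int n dvd int p - int q" if "p \<noteq> q" "p - q < n" "q - p < n" for p q
  proof
    assume "int n dvd int p - int q"
    then have "\<bar>int n\<bar> \<le> \<bar>int p - int q\<bar>" using that by (intro dvd_imp_le_int) auto
    then show False using that by linarith
  qed
  have sum_i: "(\<Sum>i<n. e \<alpha> i * cnj (e \<beta> i)) = 0" if "\<alpha> \<in> {1..n}" "\<beta> \<in> {1..n}" "\<alpha> \<noteq> \<beta>" for \<alpha> \<beta>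
    unfolding ee using n that by (intro sum_cis_root_of_unity ndvd) auto
  have sum_\<alpha>: "(\<Sum>\<alpha>\<in>{1..n}. e \<alpha> i * cnj (e \<alpha> j)) = (if i = j then of_nat n else 0)" if "i < n" "j < n" for i j
  proof (cases "i = j")
    case True
    then show ?thesis using ee1 by (simp add: mult.commute)
  next
    case False
    let ?z = "cis (2 * pi * of_int (int i - int j) / real n)"
    \<comment> \<open>Colours start at \<open>1\<close>; the shift to exponents from
      \<open>0\<close> only pulls out one factor \<open>?z\<close>.\<close>
    have "(\<Sum>\<alpha>\<in>{1..n}. ?z ^ \<alpha>) = (\<Sum>\<alpha><n. ?z ^ Suc \<alpha>)"
      by (rule sum.reindex_bij_witness[of _ Suc "\<lambda>x. x - 1"]) auto
    also have "\<dots> = ?z * (\<Sum>\<alpha><n. ?z ^ \<alpha>)" by (simp add: sum_distrib_left)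
    also have "(\<Sum>\<alpha><n. ?z ^ \<alpha>) = 0"
      using n that False by (intro sum_cis_root_of_unity ndvd) auto
    finally show ?thesis using False unfolding ee by simp
  qed
  have sq': "complex_of_real (\<sigma> v i) * complex_of_real (\<sigma> v i) = 1" if "i < n" for v i
    using sq[OF that, of v] by (simp add: power2_eq_square flip: of_real_mult)
  define w where "w v \<alpha> i = of_real (\<sigma> v i) * e \<alpha> i" for v \<alpha> i
  define P where "P v \<alpha> = mat n n (\<lambda>(i, j). w v \<alpha> i * cnj (w v \<alpha> j) / of_nat n)" for v \<alpha>
  have car: "P v \<alpha> \<in> carrier_mat n n" for v \<alpha> by (simp add: P_def)
  have prod: "(P u \<alpha> * P v \<beta>) $$ (i, j) =
     w u \<alpha> i * cnj (w v \<beta> j) * (\<Sum>l<n. cnj (w u \<alpha> l) * w v \<beta> l) / (of_nat n)\<^sup>2"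
    if "i < n" "j < n" for u v \<alpha> \<beta> i j
  proof -
    have "(P u \<alpha> * P v \<beta>) $$ (i, j) = (\<Sum>l<n. (w u \<alpha> i * cnj (w u \<alpha> l) / of_nat n) * (w v \<beta> l * cnj (w v \<beta> j) / of_nat n))"
      using that by (simp add: P_def scalar_prod_def atLeast0LessThan)
    also have "\<dots> = w u \<alpha> i * cnj (w v \<beta> j) * (\<Sum>l<n. cnj (w u \<alpha> l) * w v \<beta> l) / (of_nat n)\<^sup>2"
      by (simp add: sum_distrib_left sum_divide_distrib power2_eq_square mult_ac)
    finally show ?thesis .
  qed
  have zero: "P u \<alpha> * P v \<beta> = 0\<^sub>m n n" if "(\<Sum>l<n. cnj (w u \<alpha> l) * w v \<beta> l) = 0" for u v \<alpha> \<beta>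
    by (rule eq_matI) (use prod that in \<open>auto simp: P_def\<close>)
  have proj: "hermitian_projector n (P v \<alpha>)" for v \<alpha>
    unfolding hermitian_projector_def
  proof (intro conjI car)
    show "mat_adjoint (P v \<alpha>) = P v \<alpha>"
    proof (rule eq_matI)
      show "mat_adjoint (P v \<alpha>) $$ (i, j) = P v \<alpha> $$ (i, j)"
        if "i < dim_row (P v \<alpha>)" "j < dim_col (P v \<alpha>)" for i j
        using that mat_adjoint_index[OF car, of i j v \<alpha>] by (simp add: P_def)
    qed (auto simp: mat_adjoint_def P_def)
    have "(\<Sum>l<n. cnj (w v \<alpha> l) * w v \<alpha> l) = (\<Sum>l<n. 1)"
    proof (rule sum.cong[OF refl])
      fix l assume "l \<in> {..<n}"
      then have "cnj (w v \<alpha> l) * w v \<alpha> l = (of_real (\<sigma> v l) * of_real (\<sigma> v l)) * (cnj (e \<alpha> l) * e \<alpha> l)"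
        by (simp add: w_def mult_ac)
      then show "cnj (w v \<alpha> l) * w v \<alpha> l = 1" using sq' ee1 \<open>l \<in> {..<n}\<close> by simp
    qed
    then have "(\<Sum>l<n. cnj (w v \<alpha> l) * w v \<alpha> l) = of_nat n" by simp
    then have "(P v \<alpha> * P v \<alpha>) $$ (i, j) = P v \<alpha> $$ (i, j)" if "i < n" "j < n" for i j
      unfolding prod[OF that] using n that by (simp add: P_def power2_eq_square)
    then show "P v \<alpha> * P v \<alpha> = P v \<alpha>"
      by (intro eq_matI) (simp_all add: carrier_matD[OF car] del: index_mult_mat(1))
  qed
  have same: "P v \<alpha> * P v \<beta> = 0\<^sub>m n n" if "\<alpha> \<in> {1..n}" "\<beta> \<in> {1..n}" "\<alpha> \<noteq> \<beta>" for v \<alpha> \<beta>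
  proof (rule zero)
    have "(\<Sum>l<n. cnj (w v \<alpha> l) * w v \<beta> l) = (\<Sum>l<n. e \<beta> l * cnj (e \<alpha> l))"
    proof (rule sum.cong[OF refl])
      fix l assume "l \<in> {..<n}"
      have "cnj (w v \<alpha> l) * w v \<beta> l = (of_real (\<sigma> v l) * of_real (\<sigma> v l)) * (e \<beta> l * cnj (e \<alpha> l))"
        by (simp add: w_def mult_ac)
      then show "cnj (w v \<alpha> l) * w v \<beta> l = e \<beta> l * cnj (e \<alpha> l)" using sq' \<open>l \<in> {..<n}\<close> by simp
    qed
    then show "(\<Sum>l<n. cnj (w v \<alpha> l) * w v \<beta> l) = 0" using sum_i that by simp
  qed
  have edge: "P u \<alpha> * P v \<alpha> = 0\<^sub>m n n" if "(u, v) \<in> parcs G" for u v \<alpha>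
  proof (rule zero)
    have "cnj (w u \<alpha> l) * w v \<alpha> l = of_real (\<sigma> u l * \<sigma> v l) * (cnj (e \<alpha> l) * e \<alpha> l)" for l
      by (simp add: w_def mult_ac)
    then have "(\<Sum>l<n. cnj (w u \<alpha> l) * w v \<alpha> l) = of_real (\<Sum>l<n. \<sigma> u l * \<sigma> v l)"
      by (simp add: ee1)
    then show "(\<Sum>l<n. cnj (w u \<alpha> l) * w v \<alpha> l) = 0" using orth[OF that] by simp
  qed
  have total: "finsum (ring_mat TYPE(complex) n ()) (P v) {1..n} = 1\<^sub>m n" for v
  proof -
    have fs: "finsum (ring_mat TYPE(complex) n ()) (P v) {1..n} \<in> carrier_mat n n"
      "\<And>i j. i < n \<Longrightarrow> j < n \<Longrightarrow> finsum (ring_mat TYPE(complex) n ()) (P v) {1..n} $$ (i, j) = (\<Sum>\<alpha>\<in>{1..n}. P v \<alpha> $$ (i, j))"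
      using finsum_ring_mat[of "{1..n}" "P v" n] car by auto
    have "(\<Sum>\<alpha>\<in>{1..n}. P v \<alpha> $$ (i, j)) = (if i = j then 1 else 0)" if "i < n" "j < n" for i j
    proof -
      have "(\<Sum>\<alpha>\<in>{1..n}. P v \<alpha> $$ (i, j)) = (\<Sum>\<alpha>\<in>{1..n}. (of_real (\<sigma> v i) * of_real (\<sigma> v j) / of_nat n) * (e \<alpha> i * cnj (e \<alpha> j)))"
        using that by (intro sum.cong) (auto simp: P_def w_def mult_ac)
      also have "\<dots> = (of_real (\<sigma> v i) * of_real (\<sigma> v j) / of_nat n) * (if i = j then of_nat n else 0)"
        unfolding sum_distrib_left[symmetric] sum_\<alpha>[OF that] ..
      finally show ?thesis using sq'[OF that(1), of v] n by auto
    qed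
    then show ?thesis using fs by (intro eq_matI) auto
  qed
  have "quantum_coloring G n n P"
    unfolding quantum_coloring_def using n proj same edge total by auto
  then show ?thesis by blast
qed

section \<open>Upper and lower bounds for the two graphs\<close>

lemma pverts_johnson: "pverts (gen_johnson_graph n k s) = slice {1..n} k"
  by (simp add: gen_johnson_graph_def slice_def)

lemma parcs_johnson:
  assumes "s < k"
  shows "(A, B) \<in> parcs (gen_johnson_graph n k s) \<longleftrightarrow> A \<in> slice {1..n} k \<and> B \<in> nbrs {1..n} k s A"
  using assms by (auto simp: gen_johnson_graph_def slice_def nbrs_def)

text \<open>Sign vectors of adjacent sets differ on the \<open>2 (k - s)\<close> points of the
  symmetric difference, so their inner product is \<open>n - 4k + 4s\<close>, which
  \<open>balanced\<close> makes zero.\<close>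

lemma quantum_coloring_johnson:
  assumes n: "n > 0" and s: "s < k" and balanced: "n + 4 * s = 4 * k"
  shows "\<exists>P. quantum_coloring (gen_johnson_graph n k s) n n P"
proof (rule quantum_coloring_of_signs[where \<sigma> = "\<lambda>A i. if Suc i \<in> A then -1 else 1"])
  fix A B assume AB: "(A, B) \<in> parcs (gen_johnson_graph n k s)"
  then have A: "A \<subseteq> {1..n}" "card A = k" and B: "B \<subseteq> {1..n}" "card B = k" and s: "card (A \<inter> B) = s"
    by (auto simp: gen_johnson_graph_def)
  then show "A \<in> pverts (gen_johnson_graph n k s) \<and> B \<in> pverts (gen_johnson_graph n k s)"
    by (simp add: gen_johnson_graph_def)
  have count: "(\<Sum>i\<in>{1..n}. if i \<in> S then 1 else 0 :: real) = card S" if "S \<subseteq> {1..n}" for S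
    using that by (simp add: sum.If_cases Int_absorb1)
  have "(\<Sum>i<n. (if Suc i \<in> A then -1 else 1) * (if Suc i \<in> B then -1 else 1) :: real) =
      (\<Sum>i\<in>{1..n}. (if i \<in> A then -1 else 1) * (if i \<in> B then -1 else 1))"
    by (rule sum.reindex_bij_witness[of _ "\<lambda>x. x - 1" Suc]) auto
  also have "\<dots> = (\<Sum>i\<in>{1..n}. 1 - 2 * (if i \<in> A then 1 else 0) - 2 * (if i \<in> B then 1 else 0)
      + 4 * (if i \<in> A \<inter> B then 1 else 0))"
    by (intro sum.cong) auto
  also have "\<dots> = real n - 2 * real k - 2 * real k + 4 * real s"
    unfolding sum.distrib sum_subtractf sum_distrib_left[symmetric]
    using count[OF A(1)] count[OF B(1)] count[of "A \<inter> B"] A B s by auto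
  also have "\<dots> = 0" using arg_cong[OF balanced, of real] by simp
  finally show "(\<Sum>i<n. (if Suc i \<in> A then -1 else 1) * (if Suc i \<in> B then -1 else 1) :: real) = 0" .
qed (use n in auto)

text \<open>The least eigenvalue is some \<open>L j\<close>. For \<open>j = 0\<close> the Hoffman
  inequality would bound the positive \<open>L 0\<close> by a nonpositive number; for
  \<open>j >= 1\<close> the gap gives \<open>c - 1 > 4r - 2\<close>, which for integers is the
  claim.\<close>

lemma quantum_coloring_johnson_bound:
  fixes a r :: nat
  assumes r: "r \<ge> 5" and a: "2 \<le> a" "a\<^sup>2 \<le> r"
    and k: "k = 2 * r - a \<and> s = r - a \<or> k = 2 * r + a \<and> s = r + a"
    and col: "quantum_coloring (gen_johnson_graph (4 * r) k s) c m P"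
  shows "4 * r \<le> c"
proof -
  let ?X = "{1..4 * r}"
  let ?V = "slice ?X k"
  define L where "L = johnson_ev (2 * r - a) (2 * r + a) r"
  have a2: "2 * a \<le> r" using a by (metis mult_le_mono1 order_trans power2_eq_square)
  have sk: "s < k" "k - s = r" "k \<le> 4 * r" using k a2 r by auto
  have L: "johnson_ev k (4 * r - k) r j = L j" for j
    using k a2 by (auto simp: L_def johnson_ev_commute[of "2 * r + a"])
  have "?V \<noteq> {}"
    using sk(3) card_slice[of ?X k] by (metis card.empty binomial_eq_0_iff card_atLeastAtMost diff_Suc_1 finite_atLeastAtMost not_le)
  define M where "M A B = (if B \<in> nbrs ?X k s A then 1 else 0 :: real)" for A B
  have sym: "M A B = M B A" if "A \<in> ?V" "B \<in> ?V" for A B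
    using that by (simp add: M_def nbrs_def Int_commute)
  have "finite ?V" by simp
  obtain \<mu> and f :: "nat set \<Rightarrow> real" where nz: "\<exists>A\<in>?V. f A \<noteq> 0"
    and ev: "\<And>A. A \<in> ?V \<Longrightarrow> (\<Sum>B\<in>?V. M A B * f B) = \<mu> * f A"
    and min: "\<And>g. \<mu> * (\<Sum>A\<in>?V. (g A)\<^sup>2) \<le> (\<Sum>A\<in>?V. \<Sum>B\<in>?V. M A B * g A * g B)"
  proof (rule symmetric_min_eigenvector[OF \<open>finite ?V\<close> \<open>?V \<noteq> {}\<close> sym])
    fix \<mu> and f :: "nat set \<Rightarrow> real"
    assume "\<exists>A\<in>?V. f A \<noteq> 0" "\<And>A. A \<in> ?V \<Longrightarrow> (\<Sum>B\<in>?V. M A B * f B) = \<mu> * f A"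
      "\<And>g. \<mu> * (\<Sum>A\<in>?V. (g A)\<^sup>2) \<le> (\<Sum>A\<in>?V. \<Sum>B\<in>?V. M A B * g A * g B)"
    then show thesis by (rule that)
  qed
  have restrict: "(\<Sum>B\<in>?V. M A B * h B) = (\<Sum>B\<in>nbrs ?X k s A. h B)" for A and h :: "nat set \<Rightarrow> real"
    by (rule sum.mono_neutral_cong_right) (auto simp: nbrs_def M_def)
  have "(\<Sum>B\<in>nbrs ?X k s A. f B) = \<mu> * f A" if "A \<in> ?V" for A
    using ev[OF that] unfolding restrict .
  then obtain j where j: "j \<le> k" "j \<le> 4 * r - k" and \<mu>: "\<mu> = L j"
    using johnson_eigenvalue_cases[of ?X s k f \<mu>] sk nz L by auto
  have "real ((k choose r) * ((4 * r - k) choose r)) \<le> - \<mu> * (real c - 1)"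
  proof (rule quantum_coloring_hoffman[OF col, where nb = "nbrs ?X k s"])
    show "card (nbrs ?X k s A) = (k choose r) * ((4 * r - k) choose r)"
      if "A \<in> pverts (gen_johnson_graph (4 * r) k s)" for A
      using card_nbrs[of ?X A k s] that sk by (simp add: pverts_johnson)
    show "\<mu> * (\<Sum>u\<in>pverts (gen_johnson_graph (4 * r) k s). (g u)\<^sup>2) \<le>
      (\<Sum>u\<in>pverts (gen_johnson_graph (4 * r) k s). \<Sum>v\<in>nbrs ?X k s u. g u * g v)" for g
      using min[of g] unfolding pverts_johnson mult.assoc restrict .
  qed (use sk \<open>?V \<noteq> {}\<close> in \<open>auto simp: pverts_johnson parcs_johnson nbrs_def\<close>)
  also have "real ((k choose r) * ((4 * r - k) choose r)) = L 0"
    unfolding L[symmetric] johnson_ev_0 by simp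
  finally have L0: "L 0 \<le> - L j * (real c - 1)" unfolding \<mu> .
  have c: "real c \<ge> 1" using col by (simp add: quantum_coloring_def)
  have L0_pos: "L 0 > 0"
    unfolding L_def johnson_ev_0 using a2 by (intro mult_pos_pos) auto
  show ?thesis
  proof (cases "j = 0")
    case True
    then have "L 0 \<le> - (L 0 * (real c - 1))" using L0 by simp
    moreover have "L 0 * (real c - 1) \<ge> 0" using L0_pos c by simp
    ultimately show ?thesis using L0_pos by linarith
  next
    case False
    have "j \<le> 2 * r - a" using j k a2 by auto
    then have small: "(4 * real r - 2) * \<bar>L j\<bar> < L 0"
      unfolding L_def using False by (intro johnson_ev_small r a) auto
    also have "L 0 \<le> \<bar>L j\<bar> * (real c - 1)"
      using L0 c by (smt (verit) mult_right_mono)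
    finally have "(4 * real r - 2) * \<bar>L j\<bar> < (real c - 1) * \<bar>L j\<bar>"
      by (simp add: mult.commute)
    then have "4 * real r - 2 < real c - 1"
      by (rule mult_right_less_imp_less) simp
    then have "real (4 * r) < real (c + 1)" by simp
    then show ?thesis by linarith
  qed
qed

theorem theorem2:
  fixes a r :: nat
  assumes "r \<ge> 5" and "2 \<le> a" and "real a \<le> sqrt (real r)"
  shows "quantum_chromatic_number (gen_johnson_graph (4 * r) (2 * r - a) (r - a)) = 4 * r \<and>
         quantum_chromatic_number (gen_johnson_graph (4 * r) (2 * r + a) (r + a)) = 4 * r"
proof -
  have "(real a)\<^sup>2 \<le> real r"
    using assms(3) by (metis of_nat_0_le_iff real_le_rsqrt real_sqrt_le_iff real_sqrt_pow2 power_mono)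
  then have a: "a\<^sup>2 \<le> r" by (simp flip: of_nat_power)
  then have a2: "2 * a \<le> r" using assms(2) by (metis mult_le_mono1 order_trans power2_eq_square)
  have "quantum_chromatic_number (gen_johnson_graph (4 * r) k s) = 4 * r"
    if ks: "k = 2 * r - a \<and> s = r - a \<or> k = 2 * r + a \<and> s = r + a" for k s
    unfolding quantum_chromatic_number_def
  proof (rule Least_equality)
    have "s < k" "4 * r + 4 * s = 4 * k" using ks a2 assms(1) by auto
    then show "\<exists>m P. quantum_coloring (gen_johnson_graph (4 * r) k s) (4 * r) m P"
      using quantum_coloring_johnson[of "4 * r" s k] assms(1) by auto
  qed (use quantum_coloring_johnson_bound[OF assms(1,2) a ks] in blast)
  then show ?thesis by blast
qed

end
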